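(* Let $\theta=\mu+\sigma i$ with $\mu\in\mathbb{R}$, $\sigma>0$, let $X_1,X_2,\dots$ be i.i.d. random variables with the Cauchy distribution $P_\theta$, and let $\hat\theta_n$ be the maximum likelihood estimator of $\theta$ based on $X_1,\dots,X_n$. Then \[ \limsup_{\epsilon\to+0}\ \limsup_{n\to\infty}\frac{\log P(|\hat\theta_n-\theta|>\epsilon)}{n\,b(\epsilon,\theta)}=-1. \]
   Context: $\mathbb{H}=\{z\in\mathbb{C}:\mathrm{Im}(z)>0\}$. For $\theta=\mu+\sigma i\in\mathbb{H}$, $P_\theta(dx)=p(x;\theta)\,dx$ on $\mathbb{R}$ with $p(x;\theta)=\frac{\sigma}{\pi}\frac{1}{(x-\mu)^2+\sigma^2}$. Maximum likelihood estimator: $\hat\theta_n=\hat\theta_n(X_1,\dots,X_n)\in\mathbb{H}$ is the maximizer of the joint (location and scale) likelihood; equivalently (for $n\ge3$, almost surely) the unique solution $\alpha\in\mathbb{H}$ of $\sum_{j=1}^n\frac{X_j-\alpha}{X_j-\overline{\alpha}}=0$. Kullback–Leibler divergence: $K(P_{\theta'}|P_\theta)=\int_{\mathbb{R}}p(x;\theta')\log\frac{p(x;\theta')}{p(x;\theta)}\,dx$. Define, for $\epsilon>0$, \[ b(\epsilon,\theta)=\inf\{K(P_{\theta'}|P_\theta):\theta'\in\mathbb{H},\ |\theta'-\theta|>\epsilon\}. \] *)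

theory Defs
  imports "HOL-Probability.Probability"
begin

definition upper_half_plane :: "complex set" where
  "upper_half_plane = {z. 0 < Im z}"

text \<open>The parameter is \<open>\<theta> = \<mu> + \<sigma> \<i>\<close>, i.e. \<open>Re \<theta>\<close> is the location and \<open>Im \<theta>\<close> the scale.\<close>

definition cauchy_density :: "complex \<Rightarrow> real \<Rightarrow> real" where
  "cauchy_density \<theta> x = Im \<theta> / pi * (1 / ((x - Re \<theta>)\<^sup>2 + (Im \<theta>)\<^sup>2))"

definition cauchy_likelihood :: "nat \<Rightarrow> (nat \<Rightarrow> real) \<Rightarrow> complex \<Rightarrow> real" where
  "cauchy_likelihood n x \<alpha> = (\<Prod>j<n. cauchy_density \<alpha> (x j))"

definition is_cauchy_mle :: "nat \<Rightarrow> (nat \<Rightarrow> real) \<Rightarrow> complex \<Rightarrow> bool" where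
  "is_cauchy_mle n x \<alpha> \<longleftrightarrow> is_arg_max (cauchy_likelihood n x) (\<lambda>\<beta>. \<beta> \<in> upper_half_plane) \<alpha>"

definition cauchy_KL :: "complex \<Rightarrow> complex \<Rightarrow> real" where
  "cauchy_KL \<theta>' \<theta> =
     (\<integral>x. cauchy_density \<theta>' x * ln (cauchy_density \<theta>' x / cauchy_density \<theta> x) \<partial>lborel)"

lemma cauchy_density_pos:
  assumes "\<theta> \<in> upper_half_plane"
  shows "0 < cauchy_density \<theta> x"
  using assms unfolding cauchy_density_def upper_half_plane_def
  by (auto intro!: mult_pos_pos divide_pos_pos add_nonneg_pos)

lemma borel_measurable_cauchy_density [measurable]: "cauchy_density \<theta> \<in> borel_measurable borel"
  unfolding cauchy_density_def by measurable

text \<open>The library's \<^const>\<open>KL_divergence\<close> takes the reference measure first, so the arguments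
  appear in the opposite order.\<close>

lemma cauchy_KL_eq_KL_divergence:
  assumes "\<theta> \<in> upper_half_plane" "\<theta>' \<in> upper_half_plane"
  shows "cauchy_KL \<theta>' \<theta> =
    KL_divergence (exp 1) (density lborel (cauchy_density \<theta>)) (density lborel (cauchy_density \<theta>'))"
proof -
  have "0 < cauchy_density \<theta> x" "0 < cauchy_density \<theta>' x" for x
    using assms by (auto intro: cauchy_density_pos)
  then show ?thesis
    unfolding cauchy_KL_def
    by (subst lborel.KL_density_density) (auto simp: less_imp_le less_imp_neq[symmetric] log_def)
qed

definition cauchy_b :: "real \<Rightarrow> complex \<Rightarrow> real" where
  "cauchy_b \<epsilon> \<theta> = (INF \<theta>' \<in> {\<theta>' \<in> upper_half_plane. cmod (\<theta>' - \<theta>) > \<epsilon>}. cauchy_KL \<theta>' \<theta>)"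

end

theory Submission
  imports Defs "HOL-Real_Asymp.Real_Asymp"
begin

text \<open>The Cayley transform \<open>z \<mapsto> (z - \<theta>) / (z - cnj \<theta>)\<close> maps the upper half plane to the unit disc and \<open>P\<^sub>\<theta>\<close>
  to the uniform distribution on the unit circle. In this coordinate the negative log likelihood is
  convex along every radius with respect to hyperbolic arc length. Hence, if its radial derivative
  is positive in every direction at radius \<open>t\<close>, all maximizers have radius at most \<open>t\<close>. By Lipschitz
  continuity finitely many directions suffice, with a small loss, and Chernoff's bound with
  parameter \<open>T\<close> in each of them bounds the deviation probability by \<open>K exp (n (- T\<^sup>2/4 + 7 T\<^sup>3))\<close>, where
  \<open>T \<sim> \<epsilon>/\<sigma>\<close>, while \<open>b(\<epsilon>,\<theta>) \<le> \<epsilon>\<^sup>2/(4\<sigma>\<^sup>2)\<close>. For the opposite inequality one changes the measure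
  to a parameter \<open>\<theta>'\<close> with \<open>\<bar>\<theta>' - \<theta>\<bar> > \<epsilon>\<close>: under \<open>\<theta>'\<close> the estimator is close to \<open>\<theta>'\<close> by the same
  Chernoff bound, and the log likelihood ratio is at most \<open>n (K(P\<^sub>\<theta>'|P\<^sub>\<theta>) + \<delta>)\<close> with high probability.\<close>

section \<open>The Cayley transform of the Cauchy family\<close>

definition cayley :: "complex \<Rightarrow> complex \<Rightarrow> complex" where
  "cayley \<theta> z = (z - \<theta>) / (z - cnj \<theta>)"

lemma of_real_ne_upper:
  assumes "\<theta> \<in> upper_half_plane"
  shows "complex_of_real x \<noteq> \<theta>" "complex_of_real x \<noteq> cnj \<theta>"
  using assms by (auto simp: upper_half_plane_def complex_eq_iff)

lemma upper_ne_cnj: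
  assumes "\<theta> \<in> upper_half_plane" "\<alpha> \<in> upper_half_plane"
  shows "\<alpha> \<noteq> cnj \<theta>"
  using assms by (auto simp: upper_half_plane_def complex_eq_iff)

lemma norm_diff_cnj:
  assumes "\<theta> \<in> upper_half_plane"
  shows "norm (\<theta> - cnj \<theta>) = 2 * Im \<theta>"
  using assms by (simp add: complex_diff_cnj norm_mult upper_half_plane_def)

lemma norm_cayley_of_real:
  assumes "\<theta> \<in> upper_half_plane"
  shows "norm (cayley \<theta> (of_real x)) = 1"
proof -
  have "norm (of_real x - \<theta>) = norm (of_real x - cnj \<theta>)"
    by (simp add: cmod_def)
  then show ?thesis
    using of_real_ne_upper[OF assms, of x] by (simp add: cayley_def norm_divide)
qed

text \<open>The dictionary between disc radius and half plane: the distances of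
  \<open>\<alpha>\<close> to \<open>cnj \<theta>\<close> and to \<open>\<theta>\<close> have squares
  differing by exactly four times the product of the two scales. The disc bound, the density ratio
  and the closed form of the divergence all rest on it.\<close>

lemma one_minus_norm_cayley:
  assumes "\<theta> \<in> upper_half_plane" "\<alpha> \<in> upper_half_plane"
  shows "1 - (norm (cayley \<theta> \<alpha>))\<^sup>2 = 4 * Im \<theta> * Im \<alpha> / (norm (\<alpha> - cnj \<theta>))\<^sup>2"
proof -
  have "(norm (\<alpha> - cnj \<theta>))\<^sup>2 - (norm (\<alpha> - \<theta>))\<^sup>2 = 4 * Im \<theta> * Im \<alpha>"
    unfolding cmod_power2 by (simp add: power2_eq_square algebra_simps)
  then show ?thesis
    using upper_ne_cnj[OF assms]
    by (simp add: cayley_def norm_divide power_divide divide_simps del: power2_eq_square)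
qed

lemma norm_cayley_less_1:
  assumes "\<theta> \<in> upper_half_plane" "\<alpha> \<in> upper_half_plane"
  shows "norm (cayley \<theta> \<alpha>) < 1"
proof -
  have "0 < 1 - (norm (cayley \<theta> \<alpha>))\<^sup>2"
    unfolding one_minus_norm_cayley[OF assms]
    using assms upper_ne_cnj[OF assms] by (auto simp: upper_half_plane_def)
  then show ?thesis
    by (simp add: power_less_one_iff abs_square_less_1)
qed

lemma cayley_diff:
  assumes "a \<noteq> cnj \<theta>" "b \<noteq> cnj \<theta>"
  shows "cayley \<theta> a - cayley \<theta> b = (a - b) * (\<theta> - cnj \<theta>) / ((a - cnj \<theta>) * (b - cnj \<theta>))"
  using assms by (simp add: cayley_def divide_simps) (simp add: algebra_simps)

lemma cauchy_density_alt:
  "cauchy_density \<theta> x = Im \<theta> / pi / (norm (of_real x - \<theta>))\<^sup>2"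
  by (simp add: cauchy_density_def cmod_power2 power2_commute)

text \<open>The right-hand side is the Poisson kernel of the unit disc at the interior point
  \<open>cayley \<theta> \<alpha>\<close> and the boundary point
  \<open>cayley \<theta> (of_real x)\<close>: in the coordinate of \<open>\<theta>\<close> the
  Cauchy laws are the harmonic measures.\<close>

lemma cauchy_density_ratio:
  assumes "\<theta> \<in> upper_half_plane" "\<alpha> \<in> upper_half_plane"
  shows "cauchy_density \<alpha> x / cauchy_density \<theta> x =
    (1 - (norm (cayley \<theta> \<alpha>))\<^sup>2) / (norm (cayley \<theta> (of_real x) - cayley \<theta> \<alpha>))\<^sup>2"
proof -
  have n: "norm (of_real x - \<theta>) = norm (of_real x - cnj \<theta>)"
    by (simp add: cmod_def)
  have s: "norm (\<theta> - cnj \<theta>) = 2 * Im \<theta>"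
    using assms(1) by (rule norm_diff_cnj)
  have p: "0 < Im \<theta>" "0 < Im \<alpha>"
    using assms by (auto simp: upper_half_plane_def)
  show ?thesis
    unfolding one_minus_norm_cayley[OF assms]
    apply (subst cayley_diff)
    using of_real_ne_upper[OF assms(1)] of_real_ne_upper[OF assms(2)] upper_ne_cnj[OF assms] p
    apply (simp_all add: cauchy_density_alt norm_divide norm_mult s n power_divide power_mult_distrib)
    apply (simp add: field_simps power2_eq_square)
    done
qed

text \<open>The inverse Moebius map. The point 1 of the circle corresponds to infinity, where
  division by zero yields a meaningless value; hence the side condition \<open>w \<noteq> 1\<close>
  below.\<close>

definition cayley_inv :: "complex \<Rightarrow> complex \<Rightarrow> complex" where
  "cayley_inv \<theta> w = (\<theta> - w * cnj \<theta>) / (1 - w)"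

lemma cayley_inv_diff:
  assumes "w \<noteq> 1"
  shows "cayley_inv \<theta> w - \<theta> = (\<theta> - cnj \<theta>) * w / (1 - w)"
    "cayley_inv \<theta> w - cnj \<theta> = (\<theta> - cnj \<theta>) / (1 - w)"
  using assms by (simp_all add: cayley_inv_def divide_simps) (simp_all add: algebra_simps)

lemma cayley_cayley_inv:
  assumes "\<theta> \<in> upper_half_plane" "w \<noteq> 1"
  shows "cayley \<theta> (cayley_inv \<theta> w) = w"
  unfolding cayley_def cayley_inv_diff[OF assms(2)]
  using assms upper_ne_cnj[OF assms(1) assms(1)] by simp

lemma cayley_inv_cayley:
  assumes "\<theta> \<in> upper_half_plane" "\<alpha> \<in> upper_half_plane"
  shows "cayley_inv \<theta> (cayley \<theta> \<alpha>) = \<alpha>"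
proof -
  have ne: "\<alpha> - cnj \<theta> \<noteq> 0" "\<theta> - cnj \<theta> \<noteq> 0"
    using upper_ne_cnj[OF assms] upper_ne_cnj[OF assms(1) assms(1)] by auto
  have "1 - cayley \<theta> \<alpha> = (\<theta> - cnj \<theta>) / (\<alpha> - cnj \<theta>)"
    using ne by (simp add: cayley_def field_simps)
  moreover have "\<theta> - cayley \<theta> \<alpha> * cnj \<theta> = \<alpha> * (\<theta> - cnj \<theta>) / (\<alpha> - cnj \<theta>)"
    using ne by (simp add: cayley_def field_simps)
  ultimately show ?thesis
    using ne by (simp add: cayley_inv_def)
qed

text \<open>A modulus below 1 means that the image is closer to \<open>\<theta>\<close> than to
  \<open>cnj \<theta>\<close>, and the bisector of these two points is the real axis.\<close>

lemma cayley_inv_upper: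
  assumes "\<theta> \<in> upper_half_plane" "norm w < 1"
  shows "cayley_inv \<theta> w \<in> upper_half_plane"
proof -
  have ne: "w \<noteq> 1" using assms by auto
  define z where "z = cayley_inv \<theta> w"
  have d: "z - cnj \<theta> \<noteq> 0" "w * (z - cnj \<theta>) = z - \<theta>"
    unfolding z_def cayley_inv_diff[OF ne]
    using ne upper_ne_cnj[OF assms(1) assms(1)] by simp_all
  then have z: "w * (z - cnj \<theta>) = z - \<theta>" "z \<noteq> cnj \<theta>"
    by simp_all
  have "norm (z - \<theta>) < norm (z - cnj \<theta>)"
    unfolding z(1)[symmetric] using assms z(2) by (simp add: norm_mult)
  then have "(norm (z - \<theta>))\<^sup>2 < (norm (z - cnj \<theta>))\<^sup>2"
    by (simp add: power_strict_mono)
  then have "0 < 4 * Im \<theta> * Im z"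
    unfolding cmod_power2 by (simp add: power2_eq_square algebra_simps)
  then show ?thesis
    using assms by (simp add: upper_half_plane_def z_def zero_less_mult_iff)
qed

text \<open>Translates a disc radius into a Euclidean deviation. The bound is attained at
  \<open>w = t\<close>, which moves \<open>\<theta>\<close> vertically upwards.\<close>

lemma norm_cayley_inv_diff_le:
  assumes "\<theta> \<in> upper_half_plane" "norm w \<le> t" "t < 1"
  shows "norm (cayley_inv \<theta> w - \<theta>) \<le> 2 * Im \<theta> * t / (1 - t)"
proof -
  have s: "norm (\<theta> - cnj \<theta>) = 2 * Im \<theta>" "0 < Im \<theta>"
    using assms norm_diff_cnj by (auto simp: upper_half_plane_def)
  have ne: "w \<noteq> 1" using assms by auto
  have "1 - t \<le> norm (1 - w)"
    using norm_triangle_ineq2[of 1 w] assms by simp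
  then have "norm w / norm (1 - w) \<le> t / (1 - t)"
    using assms by (intro frac_le) (auto intro: order_trans[OF norm_ge_zero])
  then show ?thesis
    using s mult_left_mono[of _ _ "2 * Im \<theta>"]
    by (fastforce simp: cayley_inv_diff[OF ne] norm_mult norm_divide)
qed

section \<open>Total mass and circular moments of the Cauchy law\<close>

lemma cauchy_density_integral:
  assumes "\<theta> \<in> upper_half_plane"
  shows "integrable lborel (cauchy_density \<theta>)" "(\<integral>x. cauchy_density \<theta> x \<partial>lborel) = 1"
proof -
  define F where "F x = arctan ((x - Re \<theta>) / Im \<theta>) / pi" for x
  have s: "0 < Im \<theta>"
    using assms by (simp add: upper_half_plane_def)
  have D: "DERIV F x :> cauchy_density \<theta> x" for x
  proof -
    have "0 < (x - Re \<theta>)\<^sup>2 + (Im \<theta>)\<^sup>2"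
      using s by (simp add: sum_power2_gt_zero_iff)
    moreover have "1 + ((x - Re \<theta>) / Im \<theta>)\<^sup>2 = ((x - Re \<theta>)\<^sup>2 + (Im \<theta>)\<^sup>2) / (Im \<theta>)\<^sup>2"
      using s by (simp add: field_simps)
    ultimately have "inverse (1 + ((x - Re \<theta>) / Im \<theta>)\<^sup>2) * (1 / Im \<theta>) / pi = cauchy_density \<theta> x"
      using s by (simp add: cauchy_density_def power2_eq_square)
    then show ?thesis
      unfolding F_def using s by (auto intro!: derivative_eq_intros)
  qed
  have C: "isCont (cauchy_density \<theta>) x" for x
    unfolding cauchy_density_def using s by (intro continuous_intros) (auto simp: sum_power2_eq_zero_iff)
  have lims: "(F \<longlongrightarrow> - 1/2) at_bot" "(F \<longlongrightarrow> 1/2) at_top"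
    unfolding F_def using s by real_asymp+
  have "set_integrable lborel (einterval (-\<infinity>) \<infinity>) (cauchy_density \<theta>)"
    "(LBINT x=-\<infinity>..\<infinity>. cauchy_density \<theta> x) = 1/2 - (-1/2)"
    using D C lims cauchy_density_pos[OF assms]
    by (intro interval_integral_FTC_nonneg[where F=F]; auto simp: ereal_tendsto_simps less_imp_le)+
  then show "integrable lborel (cauchy_density \<theta>)" "(\<integral>x. cauchy_density \<theta> x \<partial>lborel) = 1"
    by (auto simp: set_integrable_def interval_lebesgue_integral_def set_lebesgue_integral_def)
qed

lemma borel_measurable_cayley [measurable]:
  "(\<lambda>x. cayley \<theta> (complex_of_real x)) \<in> borel_measurable borel"
  unfolding cayley_def by measurable

lemma tendsto_cayley_of_real:
  "((\<lambda>x. cayley \<theta> (of_real x)) \<longlongrightarrow> 1) at_top" "((\<lambda>x. cayley \<theta> (of_real x)) \<longlongrightarrow> 1) at_bot"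
proof -
  have *: "((\<lambda>x. cayley \<theta> (of_real x)) \<longlongrightarrow> 1) F"
    if F: "filterlim (complex_of_real) at_infinity F" for F
  proof -
    have "((\<lambda>x. (cnj \<theta> - \<theta>) / (of_real x - cnj \<theta>)) \<longlongrightarrow> 0) F"
      by (intro tendsto_divide_0[OF tendsto_const])
        (use tendsto_add_filterlim_at_infinity[OF tendsto_const F, of "- cnj \<theta>"] in simp)
    then have "((\<lambda>x. 1 + (cnj \<theta> - \<theta>) / (of_real x - cnj \<theta>)) \<longlongrightarrow> 1 + 0) F"
      by (intro tendsto_intros)
    moreover have "eventually (\<lambda>x. complex_of_real x \<noteq> cnj \<theta>) F"
      using F by (rule filterlim_at_infinity_imp_eventually_ne)
    then have "eventually (\<lambda>x. 1 + (cnj \<theta> - \<theta>) / (of_real x - cnj \<theta>) = cayley \<theta> (of_real x)) F"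
      by eventually_elim (simp add: cayley_def field_simps)
    ultimately show ?thesis
      by (simp add: filterlim_cong)
  qed
  show "((\<lambda>x. cayley \<theta> (of_real x)) \<longlongrightarrow> 1) at_top" "((\<lambda>x. cayley \<theta> (of_real x)) \<longlongrightarrow> 1) at_bot"
    by (rule *, rule filterlim_norm_at_top_imp_at_infinity, unfold norm_of_real, real_asymp)+
qed

lemma integrable_cauchy_density_scaleR:
  fixes f :: "real \<Rightarrow> 'b::{banach, second_countable_topology}"
  assumes "\<theta> \<in> upper_half_plane" "f \<in> borel_measurable borel" "\<And>x. norm (f x) \<le> B"
  shows "integrable lborel (\<lambda>x. cauchy_density \<theta> x *\<^sub>R f x)"
proof (rule Bochner_Integration.integrable_bound)
  show "integrable lborel (\<lambda>x. B * cauchy_density \<theta> x)"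
    using cauchy_density_integral[OF assms(1)] by simp
  show "AE x in lborel. norm (cauchy_density \<theta> x *\<^sub>R f x) \<le> norm (B * cauchy_density \<theta> x)"
    using assms(3) order_trans[OF norm_ge_zero assms(3)] cauchy_density_pos[OF assms(1)]
    by (auto simp: abs_mult mult.commute less_imp_le intro!: mult_right_mono)
qed (use assms(2) in measurable)

text \<open>With u the transformed observation, u'/u is 2 pi i times the density, so the integrand
  is the derivative of u^k divided by 2 pi i k. The curve u starts and ends at 1, and the boundary
  terms cancel.\<close>

lemma cauchy_moment_cayley:
  assumes "\<theta> \<in> upper_half_plane" "k > 0"
  shows "(\<integral>x. cauchy_density \<theta> x *\<^sub>R cayley \<theta> (of_real x) ^ k \<partial>lborel) = 0"
proof -
  define c where "c = 2 * of_real pi * \<i> * of_nat k"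
  define F where "F x = cayley \<theta> (of_real x) ^ k / c" for x
  define f where "f x = cauchy_density \<theta> x *\<^sub>R cayley \<theta> (of_real x) ^ k" for x
  have c: "c \<noteq> 0" using assms by (simp add: c_def)
  have D: "(F has_vector_derivative f x) (at x)" for x
    unfolding F_def
  proof (rule has_vector_derivative_real_field)
    have ne: "complex_of_real x - cnj \<theta> \<noteq> 0" "complex_of_real x - \<theta> \<noteq> 0"
      using of_real_ne_upper[OF assms(1)] by auto
    have "((\<lambda>z. cayley \<theta> z) has_field_derivative (\<theta> - cnj \<theta>) / (of_real x - cnj \<theta>)\<^sup>2) (at (of_real x))"
      unfolding cayley_def using ne
      by (auto intro!: derivative_eq_intros simp: power2_eq_square)
    then have "((\<lambda>z. cayley \<theta> z ^ k / c) has_field_derivative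
        (of_nat k * cayley \<theta> (of_real x) ^ (k - 1) * ((\<theta> - cnj \<theta>) / (of_real x - cnj \<theta>)\<^sup>2)) / c) (at (of_real x))"
      using c by (auto intro!: derivative_eq_intros)
    moreover have "(of_nat k * cayley \<theta> (of_real x) ^ (k - 1) * ((\<theta> - cnj \<theta>) / (of_real x - cnj \<theta>)\<^sup>2)) / c = f x"
    proof -
      have "(complex_of_real x - \<theta>) * (of_real x - cnj \<theta>) = of_real ((norm (of_real x - \<theta>))\<^sup>2)"
        unfolding complex_norm_square by simp
      then have d: "complex_of_real (cauchy_density \<theta> x) = Im \<theta> / pi / ((of_real x - \<theta>) * (of_real x - cnj \<theta>))"
        by (simp add: cauchy_density_alt)
      have "\<theta> - cnj \<theta> = 2 * \<i> * Im \<theta>"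
        by (simp add: complex_eq_iff)
      moreover have "cayley \<theta> (of_real x) ^ k = cayley \<theta> (of_real x) ^ (k - 1) * ((of_real x - \<theta>) / (of_real x - cnj \<theta>))"
        using assms(2) by (cases k) (simp_all add: cayley_def)
      moreover have "C * s / (B\<^sup>2 * p) = s * C / (p * B * B)" for p B C s :: complex
        by (simp add: power2_eq_square mult_ac)
      ultimately show ?thesis
        unfolding f_def scaleR_conv_of_real d c_def using ne assms(2) by simp
    qed
    ultimately show "((\<lambda>z. cayley \<theta> z ^ k / c) has_field_derivative f x) (at (of_real x))"
      by simp
  qed
  have C: "isCont f x" for x
    unfolding f_def cauchy_density_def cayley_def using assms of_real_ne_upper[OF assms(1)]
    by (intro continuous_intros) (auto simp: sum_power2_eq_zero_iff upper_half_plane_def)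
  have I: "integrable lborel f"
    unfolding f_def using assms
    by (intro integrable_cauchy_density_scaleR[where B=1]) (auto simp: norm_power norm_cayley_of_real)
  have "(F \<longlongrightarrow> 1 ^ k / c) at_top" "(F \<longlongrightarrow> 1 ^ k / c) at_bot"
    unfolding F_def using c by (intro tendsto_intros tendsto_cayley_of_real; simp)+
  then have "(LBINT x=-\<infinity>..\<infinity>. f x) = 1 ^ k / c - 1 ^ k / c"
    using D C I
    by (intro interval_integral_FTC_integrable[where F=F]) (auto simp: ereal_tendsto_simps set_integrable_def)
  then show ?thesis
    by (simp add: interval_lebesgue_integral_def set_lebesgue_integral_def f_def)
qed

section \<open>The Kullback-Leibler divergence\<close>

text \<open>The mean value property on the circle for a function analytic in the disc and zero at
  the centre: the logarithm series is integrated termwise, dominated by a geometric series, and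
  every circular moment of positive order vanishes.\<close>

lemma cauchy_mean_Ln_cayley:
  assumes "\<theta> \<in> upper_half_plane" "norm v < 1"
  shows "integrable lborel (\<lambda>x. cauchy_density \<theta> x *\<^sub>R Ln (1 - v * cayley \<theta> (of_real x)))"
    "(\<integral>x. cauchy_density \<theta> x *\<^sub>R Ln (1 - v * cayley \<theta> (of_real x)) \<partial>lborel) = 0"
proof -
  \<comment> \<open>The index starts at 0: that term is a division by zero, hence 0, which matches
    the absent constant term of the logarithm series.\<close>
  define f where "f i x = cauchy_density \<theta> x *\<^sub>R (- ((v * cayley \<theta> (of_real x)) ^ i) / of_nat i)" for i x
  have sums: "(\<lambda>i. f i x) sums (cauchy_density \<theta> x *\<^sub>R Ln (1 - v * cayley \<theta> (of_real x)))" for x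
    unfolding f_def using Ln_series'[of "- (v * cayley \<theta> (of_real x))"] assms
    by (intro sums_scaleR_right) (simp add: norm_mult norm_cayley_of_real)
  have bound: "norm (- ((v * cayley \<theta> (of_real x)) ^ i) / of_nat i) \<le> norm v ^ i" for i x
  proof (cases i)
    case (Suc j)
    have "norm v ^ i / real i \<le> norm v ^ i / 1"
      using Suc by (intro divide_left_mono) auto
    then show ?thesis
      using assms(1) by (simp add: norm_divide norm_power norm_mult norm_cayley_of_real del: of_nat_Suc)
  qed simp
  have int: "integrable lborel (f i)" for i
    unfolding f_def by (rule integrable_cauchy_density_scaleR[OF assms(1) _ bound]) measurable
  have nf: "norm (f i x) \<le> cauchy_density \<theta> x * norm v ^ i" for i x
    unfolding f_def norm_scaleR using bound cauchy_density_pos[OF assms(1), of x]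
    by (simp add: mult_left_mono)
  have geom: "summable (\<lambda>i. norm v ^ i)"
    using assms by (simp add: summable_geometric)
  have sum1: "AE x in lborel. summable (\<lambda>i. norm (f i x))"
  proof (rule AE_I2)
    fix x
    show "summable (\<lambda>i. norm (f i x))"
    proof (rule summable_comparison_test')
      show "summable (\<lambda>i. cauchy_density \<theta> x * norm v ^ i)"
        using geom by (rule summable_mult)
      show "norm (norm (f i x)) \<le> cauchy_density \<theta> x * norm v ^ i" if "i \<ge> 0" for i
        using nf by simp
    qed
  qed
  have "(\<integral>x. norm (f i x) \<partial>lborel) \<le> (\<integral>x. cauchy_density \<theta> x * norm v ^ i \<partial>lborel)" for i
      using int nf cauchy_density_integral[OF assms(1)] by (intro integral_mono) auto
    then have "norm (\<integral>x. norm (f i x) \<partial>lborel) \<le> norm v ^ i" for i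
      using cauchy_density_integral[OF assms(1)] by simp
  then have sum2: "summable (\<lambda>i. \<integral>x. norm (f i x) \<partial>lborel)"
    using geom by (rule summable_comparison_test'[rotated])
  have eq: "(\<Sum>i. f i x) = cauchy_density \<theta> x *\<^sub>R Ln (1 - v * cayley \<theta> (of_real x))" for x
    using sums by (simp add: sums_iff)
  show "integrable lborel (\<lambda>x. cauchy_density \<theta> x *\<^sub>R Ln (1 - v * cayley \<theta> (of_real x)))"
    using integrable_suminf[OF int sum1 sum2] by (simp add: eq)
  have "(\<integral>x. (\<Sum>i. f i x) \<partial>lborel) = (\<Sum>i. integral\<^sup>L lborel (f i))"
    by (rule integral_suminf[OF int sum1 sum2])
  moreover have "integral\<^sup>L lborel (f i) = 0" for i
  proof (cases "i = 0")
    case False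
    have f: "f i = (\<lambda>x. (- (v ^ i) / of_nat i) * (cauchy_density \<theta> x *\<^sub>R cayley \<theta> (of_real x) ^ i))"
      by (simp add: f_def power_mult_distrib scaleR_conv_of_real fun_eq_iff)
    show ?thesis
      unfolding f integral_mult_right_zero using cauchy_moment_cayley[OF assms(1), of i] False by simp
  qed (simp add: f_def [abs_def])
  ultimately show "(\<integral>x. cauchy_density \<theta> x *\<^sub>R Ln (1 - v * cayley \<theta> (of_real x)) \<partial>lborel) = 0"
    by (simp add: eq)
qed

text \<open>Reflecting \<open>w\<close> in the circle replaces the distance by the modulus of a
  function that is analytic in \<open>u\<close> and has no zero in the closed disc when
  \<open>norm w < 1\<close>, so that its logarithm is the real part of a holomorphic
  function.\<close>

lemma norm_diff_unit:
  fixes u w :: complex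
  assumes "norm u = 1"
  shows "norm (u - w) = norm (1 - cnj w * u)"
proof -
  have "u * cnj u = 1"
    using assms complex_norm_square[of u] by simp
  then have "u * cnj (1 - cnj w * u) = u - w"
    by (simp add: algebra_simps)
  then show ?thesis
    by (metis assms complex_mod_cnj mult_1 norm_mult)
qed

text \<open>In the coordinate of \<open>\<theta>'\<close>, the law with respect to which the
  divergence integrates, the log density ratio is a constant plus a harmonic function of mean zero.
  Only the constant survives.\<close>

lemma cauchy_KL_eq:
  assumes "\<theta> \<in> upper_half_plane" "\<theta>' \<in> upper_half_plane"
  shows "cauchy_KL \<theta>' \<theta> = - ln (1 - (norm (cayley \<theta>' \<theta>))\<^sup>2)"
proof -
  define w where "w = cayley \<theta>' \<theta>"
  have w: "norm w < 1"
    unfolding w_def using assms by (intro norm_cayley_less_1)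
  define u where "u x = cayley \<theta>' (complex_of_real x)" for x
  have u: "norm (u x) = 1" for x
    unfolding u_def using assms(2) by (rule norm_cayley_of_real)
  have ne: "1 - cnj w * u x \<noteq> 0" for x
    using w u[of x] by (metis complex_mod_cnj eq_iff_diff_eq_0 mult.right_neutral norm_mult norm_one order_less_irrefl)
  have w2: "0 < 1 - (norm w)\<^sup>2"
    using w by (simp add: abs_square_less_1)
  have ln_ratio: "ln (cauchy_density \<theta>' x / cauchy_density \<theta> x) = - ln (1 - (norm w)\<^sup>2) + 2 * Re (Ln (1 - cnj w * u x))" for x
  proof -
    have "cauchy_density \<theta>' x / cauchy_density \<theta> x = (norm (1 - cnj w * u x))\<^sup>2 / (1 - (norm w)\<^sup>2)"
      using cauchy_density_ratio[OF assms(2) assms(1), of x] norm_diff_unit[OF u, of x w]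
      by (simp add: w_def u_def) (metis inverse_divide)
    then show ?thesis
      using ne[of x] w2 by (simp add: ln_div ln_realpow)
  qed
  have I: "integrable lborel (\<lambda>x. cauchy_density \<theta>' x *\<^sub>R Ln (1 - cnj w * u x))"
    unfolding u_def using assms(2) w by (intro cauchy_mean_Ln_cayley) auto
  have "cauchy_KL \<theta>' \<theta> = (\<integral>x. - ln (1 - (norm w)\<^sup>2) * cauchy_density \<theta>' x +
      2 * Re (cauchy_density \<theta>' x *\<^sub>R Ln (1 - cnj w * u x)) \<partial>lborel)"
    unfolding cauchy_KL_def ln_ratio by (simp add: algebra_simps)
  also have "\<dots> = - ln (1 - (norm w)\<^sup>2) + 2 * Re (\<integral>x. cauchy_density \<theta>' x *\<^sub>R Ln (1 - cnj w * u x) \<partial>lborel)"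
    using I integrable_Re[OF I] integral_Re[OF I] cauchy_density_integral[OF assms(2)]
    by (subst Bochner_Integration.integral_add) auto
  also have "(\<integral>x. cauchy_density \<theta>' x *\<^sub>R Ln (1 - cnj w * u x) \<partial>lborel) = 0"
    unfolding u_def using assms(2) w by (intro cauchy_mean_Ln_cayley) auto
  finally show ?thesis
    by (simp add: w_def)
qed

text \<open>The same divergence in half-plane terms, where its dependence on the Euclidean distance
  and on the two scales can be read off for the bounds on \<open>cauchy_b\<close>.\<close>

lemma cauchy_KL_eq_ln:
  assumes "\<theta> \<in> upper_half_plane" "\<theta>' \<in> upper_half_plane"
  shows "cauchy_KL \<theta>' \<theta> = ln (1 + (norm (\<theta>' - \<theta>))\<^sup>2 / (4 * Im \<theta> * Im \<theta>'))"
proof -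
  have p: "0 < Im \<theta>" "0 < Im \<theta>'"
    using assms by (auto simp: upper_half_plane_def)
  have n: "0 < (norm (\<theta> - cnj \<theta>'))\<^sup>2"
    using upper_ne_cnj[OF assms(2,1)] by simp
  have "(norm (\<theta> - cnj \<theta>'))\<^sup>2 = (norm (\<theta>' - \<theta>))\<^sup>2 + 4 * Im \<theta> * Im \<theta>'"
    unfolding cmod_power2 by (simp add: power2_eq_square algebra_simps)
  then have "inverse (1 - (norm (cayley \<theta>' \<theta>))\<^sup>2) = 1 + (norm (\<theta>' - \<theta>))\<^sup>2 / (4 * Im \<theta> * Im \<theta>')"
    unfolding one_minus_norm_cayley[OF assms(2,1)] using p n by (simp add: field_simps)
  moreover have "0 < 1 - (norm (cayley \<theta>' \<theta>))\<^sup>2"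
    unfolding one_minus_norm_cayley[OF assms(2,1)] using p n by simp
  ultimately show ?thesis
    unfolding cauchy_KL_eq[OF assms] by (metis ln_inverse)
qed

section \<open>The radial score\<close>

text \<open>For a unit vector \<open>e\<close> this is the cosine of the angle between
  \<open>e\<close> and the transformed observation; along the radius in direction \<open>e\<close>
  the likelihood depends on the observation only through it.\<close>

definition cayley_cos :: "complex \<Rightarrow> complex \<Rightarrow> real \<Rightarrow> real" where
  "cayley_cos \<theta> e x = Re (cnj e * cayley \<theta> (of_real x))"

lemma borel_measurable_cayley_cos [measurable]: "cayley_cos \<theta> e \<in> borel_measurable borel"
  unfolding cayley_cos_def by measurable

lemma abs_cayley_cos_le_1:
  assumes "\<theta> \<in> upper_half_plane" "norm e = 1"
  shows "\<bar>cayley_cos \<theta> e x\<bar> \<le> 1"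
  using abs_Re_le_cmod[of "cnj e * cayley \<theta> (of_real x)"] assms
  by (simp add: cayley_cos_def norm_mult norm_cayley_of_real)

text \<open>On the unit circle the squared real part is 1/2 plus half the real part of the square,
  so the vanishing circular moments of orders 1 and 2 give both values.\<close>

lemma cauchy_moment_cayley_cos:
  assumes "\<theta> \<in> upper_half_plane" "norm e = 1"
  shows "(\<integral>x. cauchy_density \<theta> x * cayley_cos \<theta> e x \<partial>lborel) = 0"
    "(\<integral>x. cauchy_density \<theta> x * (cayley_cos \<theta> e x)\<^sup>2 \<partial>lborel) = 1/2"
proof -
  define u where "u x = cayley \<theta> (complex_of_real x)" for x
  have [measurable]: "u \<in> borel_measurable borel"
    unfolding u_def by measurable
  have u: "norm (u x) = 1" for x
    unfolding u_def using assms(1) by (rule norm_cayley_of_real)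
  have I: "integrable lborel (\<lambda>x. cauchy_density \<theta> x *\<^sub>R u x ^ k)" for k
    using assms(1) by (rule integrable_cauchy_density_scaleR[where B=1]) (auto simp: norm_power u)
  have M: "(\<integral>x. Re (a * (cauchy_density \<theta> x *\<^sub>R u x ^ k)) \<partial>lborel) = 0" if "k > 0" for a k
  proof (subst integral_Re)
    show "Re (\<integral>x. a * (cauchy_density \<theta> x *\<^sub>R u x ^ k) \<partial>lborel) = 0"
      unfolding integral_mult_right_zero u_def cauchy_moment_cayley[OF assms(1) that] by simp
  qed (intro integrable_mult_right I)
  show "(\<integral>x. cauchy_density \<theta> x * cayley_cos \<theta> e x \<partial>lborel) = 0"
    using M[of 1 "cnj e"] by (simp add: cayley_cos_def u_def algebra_simps)
  have sq: "(Re z)\<^sup>2 = 1/2 + Re (z\<^sup>2) / 2" if "norm z = 1" for z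
    using that cmod_power2[of z] by (simp add: power2_eq_square field_simps)
  have "(\<integral>x. cauchy_density \<theta> x * (cayley_cos \<theta> e x)\<^sup>2 \<partial>lborel) =
      (\<integral>x. cauchy_density \<theta> x / 2 + Re ((cnj e)\<^sup>2 / 2 * (cauchy_density \<theta> x *\<^sub>R u x ^ 2)) \<partial>lborel)"
  proof (intro Bochner_Integration.integral_cong refl)
    fix x
    have "(cayley_cos \<theta> e x)\<^sup>2 = 1/2 + Re ((cnj e * u x)\<^sup>2) / 2"
      unfolding cayley_cos_def u_def[symmetric] using u assms(2) by (intro sq) (simp add: norm_mult)
    moreover have "(cnj e)\<^sup>2 / 2 * (cauchy_density \<theta> x *\<^sub>R u x ^ 2) = (cauchy_density \<theta> x / 2) *\<^sub>R (cnj e * u x)\<^sup>2"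
      by (simp add: power_mult_distrib scaleR_conv_of_real)
    ultimately show "cauchy_density \<theta> x * (cayley_cos \<theta> e x)\<^sup>2 =
        cauchy_density \<theta> x / 2 + Re ((cnj e)\<^sup>2 / 2 * (cauchy_density \<theta> x *\<^sub>R u x ^ 2))"
      by (simp add: algebra_simps)
  qed
  also have "\<dots> = 1/2"
    using cauchy_density_integral[OF assms(1)] integrable_Re[OF integrable_mult_right[OF I]] M[of 2]
    by (subst Bochner_Integration.integral_add) (simp_all del: Re_divide_numeral times_complex.sel)
  finally show "(\<integral>x. cauchy_density \<theta> x * (cayley_cos \<theta> e x)\<^sup>2 \<partial>lborel) = 1/2" .
qed

text \<open>In the disc coordinate of \<open>\<theta>\<close>, a radius in the direction \<open>e\<close> is a hyperbolic geodesic. At arc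
  length \<open>s\<close>, i.e. at \<open>w = tanh (s/2) e\<close>, the negative log likelihood ratio of an observation with
  \<open>c = cayley_cos \<theta> e x\<close> is \<open>ln (cosh s - c sinh s)\<close>, and \<open>score (tanh s) c\<close> is its derivative.
  For \<open>t = tanh (s/2)\<close> one has \<open>tanh s = 2t / (1 + t\<^sup>2)\<close>.\<close>

definition score :: "real \<Rightarrow> real \<Rightarrow> real" where
  "score T c = (T - c) / (1 - T * c)"

lemma one_minus_mult_pos:
  fixes T c :: real
  assumes "\<bar>T\<bar> < 1" "\<bar>c\<bar> \<le> 1"
  shows "0 < 1 - T * c"
proof -
  have "\<bar>T * c\<bar> \<le> \<bar>T\<bar> * 1"
    unfolding abs_mult using assms by (intro mult_left_mono) auto
  then show ?thesis using assms by linarith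
qed

lemma abs_score_le_1:
  assumes "0 < T" "T < 1" "\<bar>c\<bar> \<le> 1"
  shows "\<bar>score T c\<bar> \<le> 1"
proof -
  have p: "0 < 1 - T * c"
    using assms by (intro one_minus_mult_pos) auto
  have "0 \<le> (1 - T) * (1 + c)" "0 \<le> (1 + T) * (1 - c)"
    using assms by (auto intro!: mult_nonneg_nonneg)
  then have "\<bar>T - c\<bar> \<le> 1 - T * c"
    by (auto simp: algebra_simps abs_if)
  then show ?thesis
    using p by (simp add: score_def abs_divide)
qed

lemma score_eq:
  assumes "0 < T" "T < 1" "\<bar>c\<bar> \<le> 1"
  shows "score T c = T - c + T * c * score T c"
  using one_minus_mult_pos[of T c] assms by (simp add: score_def field_simps)

text \<open>To second order the score is \<open>T - c - T * c\<^sup>2\<close>. The linear term of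
  the exponential then contributes \<open>T\<^sup>2 * c\<^sup>2\<close> and the quadratic term half
  of it, which explains the coefficient 3/2; everything else is of order
  \<open>T ^ 3\<close>.\<close>

lemma exp_score_le:
  assumes "0 < T" "T \<le> 1/2" "\<bar>c\<bar> \<le> 1"
  shows "exp (- T * score T c) \<le> 1 - T\<^sup>2 + T * c + 3/2 * T\<^sup>2 * c\<^sup>2 + 6 * T ^ 3"
proof -
  define g where "g = score T c"
  have g: "\<bar>g\<bar> \<le> 1" "g = T - c + T * c * g"
    unfolding g_def using assms by (auto intro: abs_score_le_1 score_eq)
  define y where "y = - T * g"
  have y: "\<bar>y\<bar> \<le> T"
    using g assms by (simp add: y_def abs_mult mult_left_le)
  obtain s where s: "\<bar>s\<bar> \<le> \<bar>y\<bar>" "exp y = (\<Sum>m<3. y ^ m / fact m) + exp s / fact 3 * y ^ 3"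
    using Maclaurin_exp_le[of y 3] by blast
  have "exp s \<le> 3"
    using exp_le exp_le_cancel_iff[of s 1] s(1) y assms(2) by linarith
  moreover have "y ^ 3 \<le> T ^ 3"
  proof -
    have "\<bar>y ^ 3\<bar> \<le> T ^ 3"
      unfolding power_abs using y by (intro power_mono) auto
    then show ?thesis by simp
  qed
  ultimately have "exp s * y ^ 3 \<le> 3 * T ^ 3"
  proof -
    assume a: "exp s \<le> 3" "y ^ 3 \<le> T ^ 3"
    have "exp s * y ^ 3 \<le> exp s * T ^ 3"
      using a(2) by (intro mult_left_mono) auto
    also have "\<dots> \<le> 3 * T ^ 3"
      using a(1) assms by (intro mult_right_mono) auto
    finally show ?thesis .
  qed
  then have e: "exp y \<le> 1 + y + y\<^sup>2 / 2 + T ^ 3 / 2"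
  proof -
    have "(\<Sum>m<3. y ^ m / fact m) = 1 + y + y\<^sup>2 / 2" "fact 3 = (6::real)"
      by (simp_all add: eval_nat_numeral)
    then show "exp y \<le> 1 + y + y\<^sup>2 / 2 + T ^ 3 / 2"
      unfolding s(2) using \<open>exp s * y ^ 3 \<le> 3 * T ^ 3\<close> by simp
  qed
  have cg: "\<bar>c * g\<bar> \<le> 1"
    using assms g(1) mult_mono[of "\<bar>c\<bar>" 1 "\<bar>g\<bar>" 1] by (simp add: abs_mult)
  have ccg: "\<bar>c * (c * g)\<bar> \<le> 1"
    using assms cg mult_mono[of "\<bar>c\<bar>" 1 "\<bar>c * g\<bar>" 1] by (simp add: abs_mult)
  have "g = T - c + T * c * (T - c + T * c * g)"
    using g(2) by metis
  then have g2: "g = T - c - T * c\<^sup>2 + T\<^sup>2 * (c + c * (c * g))"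
    by (simp add: algebra_simps power2_eq_square)
  have "T\<^sup>2 * (c + c * (c * g)) \<ge> T\<^sup>2 * (- 2)"
    using ccg assms by (intro mult_left_mono) auto
  then have "g \<ge> T - c - T * c\<^sup>2 - 2 * T\<^sup>2"
    using g2 by linarith
  then have "T * g \<ge> T * (T - c - T * c\<^sup>2 - 2 * T\<^sup>2)"
    using assms by (intro mult_left_mono) auto
  then have y1: "y \<le> - T\<^sup>2 + T * c + T\<^sup>2 * c\<^sup>2 + 2 * T ^ 3"
    by (simp add: y_def algebra_simps power2_eq_square power3_eq_cube)
  have "g\<^sup>2 = c\<^sup>2 - 2 * (T * (c + c * (c * g))) + T\<^sup>2 * (1 + c * g)\<^sup>2"
  proof -
    have "g\<^sup>2 = (- c + T * (1 + c * g))\<^sup>2"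
      by (subst g(2)) (simp add: algebra_simps)
    then show ?thesis
      by (simp add: power2_eq_square algebra_simps)
  qed
  moreover have "T * (c + c * (c * g)) \<ge> T * (- 2)"
    using ccg assms by (intro mult_left_mono) auto
  \<comment> \<open>The quadratic remainder becomes linear through \<open>T \<le> 1/2\<close> and
    gives 2T; with 4T from the cross term this makes 6T.\<close>
  moreover have "T\<^sup>2 * (1 + c * g)\<^sup>2 \<le> T * (1/2) * 4"
  proof (intro mult_mono)
    show "T\<^sup>2 \<le> T * (1/2)"
      using assms by (simp add: power2_eq_square)
    show "(1 + c * g)\<^sup>2 \<le> 4"
      using power_mono[of "\<bar>1 + c * g\<bar>" 2 2] cg by simp
  qed (use assms in auto)
  ultimately have "g\<^sup>2 \<le> c\<^sup>2 + 6 * T"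
    using assms by linarith
  then have "T\<^sup>2 * g\<^sup>2 \<le> T\<^sup>2 * (c\<^sup>2 + 6 * T)"
    by (intro mult_left_mono) auto
  then have "y\<^sup>2 \<le> T\<^sup>2 * c\<^sup>2 + 6 * T ^ 3"
    by (simp add: y_def power_mult_distrib algebra_simps power2_eq_square power3_eq_cube)
  \<comment> \<open>The cubic contributions are 2 from \<open>y\<close>, 3 from half of
    \<open>y\<^sup>2\<close> and 1/2 from the Taylor remainder, rounded up to 6.\<close>
  then have "exp y \<le> 1 - T\<^sup>2 + T * c + 3/2 * T\<^sup>2 * c\<^sup>2 + 6 * T ^ 3"
    using e y1 zero_le_power[of T 3] assms by linarith
  then show ?thesis
    by (simp add: y_def g_def)
qed

text \<open>The constant depends on \<open>T\<close> alone, not on the observation; this uniformity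
  is what allows a finite set of directions to serve all samples.\<close>

lemma score_lipschitz:
  assumes "0 < T" "T < 1" "\<bar>c\<bar> \<le> 1" "\<bar>d\<bar> \<le> 1"
  shows "\<bar>score T c - score T d\<bar> \<le> \<bar>c - d\<bar> / (1 - T)\<^sup>2"
proof -
  have p: "1 - T \<le> 1 - T * c" "1 - T \<le> 1 - T * d"
    using assms mult_left_mono[of c 1 T] mult_left_mono[of d 1 T] by auto
  have pos: "0 < 1 - T * c" "0 < 1 - T * d"
    using assms by (auto intro!: one_minus_mult_pos simp del: less_iff_diff_less_0 diff_gt_0_iff_gt)
  have "score T c - score T d = (1 - T\<^sup>2) * (d - c) / ((1 - T * c) * (1 - T * d))"
    using pos
    by (simp add: score_def diff_frac_eq) (simp add: algebra_simps power2_eq_square)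
  then have "\<bar>score T c - score T d\<bar> = (1 - T\<^sup>2) * \<bar>c - d\<bar> / ((1 - T * c) * (1 - T * d))"
    using assms pos by (simp add: abs_mult abs_minus_commute abs_of_pos power_le_one)
  also have "\<dots> \<le> 1 * \<bar>c - d\<bar> / ((1 - T) * (1 - T))"
    using assms p pos by (intro frac_le mult_mono mult_right_mono) auto
  finally show ?thesis
    by (simp add: power2_eq_square)
qed

text \<open>Geodesic convexity: \<open>ln E\<close> is the hyperbolic distance of the points of radius \<open>t\<close> and \<open>\<rho>\<close>, and with
  \<open>g\<close> the score the quotient on the right is \<open>(1 + g)/2 E + (1 - g)/2 inverse E\<close>, so that convexity of the
  exponential function applies.\<close>

lemma score_ln_le:
  assumes "0 < t" "t < \<rho>" "\<rho> < 1" "\<bar>c\<bar> \<le> 1"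
  shows "score (2 * t / (1 + t\<^sup>2)) c * ln ((1 + \<rho>) * (1 - t) / ((1 - \<rho>) * (1 + t)))
     \<le> ln ((1 + \<rho>\<^sup>2 - 2 * \<rho> * c) * (1 - t\<^sup>2) / ((1 - \<rho>\<^sup>2) * (1 + t\<^sup>2 - 2 * t * c)))"
proof -
  define E where "E = (1 + \<rho>) * (1 - t) / ((1 - \<rho>) * (1 + t))"
  define D where "D = 1 + t\<^sup>2 - 2 * t * c"
  define g where "g = score (2 * t / (1 + t\<^sup>2)) c"
  have E: "0 < E"
    unfolding E_def using assms by simp
  have "D = (1 - t)\<^sup>2 + 2 * t * (1 - c)"
    by (simp add: D_def power2_eq_square algebra_simps)
  then have D: "0 < D"
    using assms by (auto intro!: add_pos_nonneg)
  have t2: "0 < 1 + t\<^sup>2"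
    by (simp add: add_pos_nonneg)
  have "g = (2 * t / (1 + t\<^sup>2) - c) * (1 + t\<^sup>2) / ((1 - 2 * t / (1 + t\<^sup>2) * c) * (1 + t\<^sup>2))"
    unfolding g_def score_def using t2 by simp
  also have "\<dots> = (2 * t - c * (1 + t\<^sup>2)) / D"
    using t2 by (intro arg_cong2[of _ _ _ _ "(/)"]) (simp_all add: D_def left_diff_distrib)
  finally have g: "g = (2 * t - c * (1 + t\<^sup>2)) / D" .
  have gp: "1 + g = (1 + t)\<^sup>2 * (1 - c) / D" "1 - g = (1 - t)\<^sup>2 * (1 + c) / D"
    unfolding g using D by (simp_all add: add_divide_eq_iff diff_divide_eq_iff D_def power2_eq_square algebra_simps)
  then have g1: "0 \<le> 1 + g" "0 \<le> 1 - g"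
    using D assms by auto
  have ne: "1 - \<rho> \<noteq> 0" "1 + \<rho> \<noteq> 0" "1 - t \<noteq> 0" "1 + t \<noteq> 0" "D \<noteq> 0"
    using assms D by auto
  have fact: "1 - \<rho>\<^sup>2 = (1 - \<rho>) * (1 + \<rho>)" "1 - t\<^sup>2 = (1 - t) * (1 + t)"
    by (simp_all add: power2_eq_square algebra_simps)
  have Q: "(1 + \<rho>\<^sup>2 - 2 * \<rho> * c) * (1 - t\<^sup>2) / ((1 - \<rho>\<^sup>2) * D) = (1 + g) / 2 * E + (1 - g) / 2 * inverse E"
  proof -
    have "(1 + g) / 2 * E = (1 - t\<^sup>2) / (2 * D * (1 - \<rho>\<^sup>2)) * ((1 - c) * (1 + \<rho>)\<^sup>2)"
      unfolding gp E_def fact using ne by (simp add: power2_eq_square divide_simps)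
    moreover have "(1 - g) / 2 * inverse E = (1 - t\<^sup>2) / (2 * D * (1 - \<rho>\<^sup>2)) * ((1 + c) * (1 - \<rho>)\<^sup>2)"
      unfolding gp E_def fact using ne by (simp add: power2_eq_square divide_simps)
    moreover have "(1 - c) * (1 + \<rho>)\<^sup>2 + (1 + c) * (1 - \<rho>)\<^sup>2 = 2 * (1 + \<rho>\<^sup>2 - 2 * \<rho> * c)"
      by (simp add: power2_eq_square algebra_simps)
    ultimately have "(1 + g) / 2 * E + (1 - g) / 2 * inverse E = (1 - t\<^sup>2) / (2 * D * (1 - \<rho>\<^sup>2)) * (2 * (1 + \<rho>\<^sup>2 - 2 * \<rho> * c))"
      by (simp only: distrib_left[symmetric])
    moreover have "a / (2 * d * r) * (2 * x) = x * a / (r * d)" for a d r x :: real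
      by (simp add: mult_ac)
    ultimately show ?thesis
      by (simp only:)
  qed
  have "exp ((1 + g) / 2 * ln E + (1 - g) / 2 * (- ln E)) \<le> (1 + g) / 2 * exp (ln E) + (1 - g) / 2 * exp (- ln E)"
    using convex_onD[OF convex_on_exp[of 1], of "(1 - g) / 2" "ln E" "- ln E"] g1 by (simp add: field_simps)
  then have "exp (g * ln E) \<le> (1 + g) / 2 * E + (1 - g) / 2 * inverse E"
    using E by (simp add: exp_minus field_simps)
  then have "g * ln E \<le> ln ((1 + g) / 2 * E + (1 - g) / 2 * inverse E)"
    by (metis exp_gt_zero exp_le_cancel_iff exp_ln order_less_le_trans)
  then show ?thesis
    unfolding Q[symmetric] by (simp add: g_def E_def D_def)
qed

section \<open>Localization of the maximum likelihood estimator\<close>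

lemma norm_diff_polar:
  fixes u e :: complex and r :: real
  assumes "norm u = 1" "norm e = 1"
  shows "(norm (u - of_real r * e))\<^sup>2 = 1 + r\<^sup>2 - 2 * r * Re (cnj e * u)"
proof -
  have "(Re u)\<^sup>2 + (Im u)\<^sup>2 = 1" "(Re e)\<^sup>2 + (Im e)\<^sup>2 = 1"
    using assms cmod_power2[of u] cmod_power2[of e] by simp_all
  moreover have "(norm (u - of_real r * e))\<^sup>2 = ((Re u)\<^sup>2 + (Im u)\<^sup>2) + r\<^sup>2 * ((Re e)\<^sup>2 + (Im e)\<^sup>2) - 2 * r * Re (cnj e * u)"
    unfolding cmod_power2 by (simp add: power2_eq_square algebra_simps)
  ultimately show ?thesis
    by simp
qed

lemma cauchy_density_polar:
  assumes "\<theta> \<in> upper_half_plane" "norm e = 1" "0 \<le> r" "r < 1"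
  shows "cauchy_density (cayley_inv \<theta> (of_real r * e)) x =
    cauchy_density \<theta> x * ((1 - r\<^sup>2) / (1 + r\<^sup>2 - 2 * r * cayley_cos \<theta> e x))"
proof -
  have w: "norm (of_real r * e) < 1"
    using assms by (simp add: norm_mult)
  then have "of_real r * e \<noteq> 1"
    by auto
  then have "cauchy_density (cayley_inv \<theta> (of_real r * e)) x / cauchy_density \<theta> x =
      (1 - r\<^sup>2) / (1 + r\<^sup>2 - 2 * r * cayley_cos \<theta> e x)"
    using cauchy_density_ratio[OF assms(1) cayley_inv_upper[OF assms(1) w], of x]
      norm_diff_polar[OF norm_cayley_of_real[OF assms(1)] assms(2), of x r]
    by (simp add: cayley_cayley_inv[OF assms(1)] cayley_cos_def norm_mult power_mult_distrib assms(2)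
        del: times_complex.sel)
  then show ?thesis
    using cauchy_density_pos[OF assms(1), of x] by (metis less_irrefl mult.commute nonzero_divide_eq_eq)
qed

text \<open>By convexity along the radius through \<open>\<beta>\<close>, a negative log likelihood
  that increases at radius \<open>t\<close> keeps increasing beyond it. The factor
  \<open>ln E\<close> is positive and common to all observations, so the pointwise inequalities add
  up to a bound in terms of the total score.\<close>

lemma cauchy_likelihood_less:
  assumes "\<theta> \<in> upper_half_plane" "\<beta> \<in> upper_half_plane" "0 < t" "t < norm (cayley \<theta> \<beta>)"
    and pos: "0 < (\<Sum>j<n. score (2 * t / (1 + t\<^sup>2)) (cayley_cos \<theta> (sgn (cayley \<theta> \<beta>)) (x j)))"
  shows "cauchy_likelihood n x \<beta> < cauchy_likelihood n x (cayley_inv \<theta> (of_real t * sgn (cayley \<theta> \<beta>)))"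
proof -
  define \<rho> where "\<rho> = norm (cayley \<theta> \<beta>)"
  define e where "e = sgn (cayley \<theta> \<beta>)"
  define \<alpha> where "\<alpha> = cayley_inv \<theta> (of_real t * e)"
  define E where "E = (1 + \<rho>) * (1 - t) / ((1 - \<rho>) * (1 + t))"
  have \<rho>: "t < \<rho>" "\<rho> < 1"
    using assms norm_cayley_less_1[OF assms(1,2)] by (auto simp: \<rho>_def)
  have e: "norm e = 1"
    using \<rho> assms(3) by (auto simp: e_def \<rho>_def norm_sgn)
  have "norm (of_real t * e) < 1"
    using assms \<rho> e by (simp add: norm_mult)
  then have \<alpha>: "\<alpha> \<in> upper_half_plane"
    unfolding \<alpha>_def using assms by (intro cayley_inv_upper)
  have \<beta>: "\<beta> = cayley_inv \<theta> (of_real \<rho> * e)"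
    using cayley_inv_cayley[OF assms(1,2)] \<rho> assms(3) by (simp add: \<rho>_def e_def sgn_eq)
  have "1 < E"
  proof -
    have "(1 - \<rho>) * (1 + t) < (1 + \<rho>) * (1 - t)"
      using \<rho> by (simp add: algebra_simps)
    then show ?thesis
      unfolding E_def using \<rho> assms(3) by simp
  qed
  have step: "score (2 * t / (1 + t\<^sup>2)) (cayley_cos \<theta> e (x j)) * ln E
      \<le> ln (cauchy_density \<alpha> (x j)) - ln (cauchy_density \<beta> (x j))" for j
  proof -
    define c where "c = cayley_cos \<theta> e (x j)"
    have c: "\<bar>c\<bar> \<le> 1"
      unfolding c_def using assms(1) e by (rule abs_cayley_cos_le_1)
    have D: "0 < 1 + s\<^sup>2 - 2 * s * c" if "0 \<le> s" "s < 1" for s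
    proof -
      have "1 + s\<^sup>2 - 2 * s * c = (1 - s)\<^sup>2 + 2 * s * (1 - c)"
        by (simp add: power2_eq_square algebra_simps)
      then show ?thesis
        using that c by (auto intro!: add_pos_nonneg)
    qed
    have p: "0 < cauchy_density \<theta> (x j)"
      using assms(1) by (rule cauchy_density_pos)
    have "cauchy_density \<alpha> (x j) / cauchy_density \<beta> (x j) =
        (1 + \<rho>\<^sup>2 - 2 * \<rho> * c) * (1 - t\<^sup>2) / ((1 - \<rho>\<^sup>2) * (1 + t\<^sup>2 - 2 * t * c))"
      unfolding \<beta> \<alpha>_def using assms(1,3) \<rho> e p
      by (simp add: cauchy_density_polar c_def[symmetric]) (simp only: mult_ac)
    moreover have "ln (cauchy_density \<alpha> (x j) / cauchy_density \<beta> (x j)) =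
        ln (cauchy_density \<alpha> (x j)) - ln (cauchy_density \<beta> (x j))"
      using cauchy_density_pos[OF \<alpha>, of "x j"] cauchy_density_pos[OF assms(2), of "x j"]
      by (simp add: ln_div)
    ultimately show ?thesis
      using score_ln_le[OF assms(3) \<rho> c] by (simp only: E_def c_def[symmetric])
  qed
  have "0 < (\<Sum>j<n. score (2 * t / (1 + t\<^sup>2)) (cayley_cos \<theta> e (x j))) * ln E"
    using pos \<open>1 < E\<close> by (simp add: e_def)
  also have "\<dots> \<le> (\<Sum>j<n. ln (cauchy_density \<alpha> (x j)) - ln (cauchy_density \<beta> (x j)))"
    unfolding sum_distrib_right by (intro sum_mono step)
  also have "\<dots> = ln (cauchy_likelihood n x \<alpha>) - ln (cauchy_likelihood n x \<beta>)"
    using cauchy_density_pos[OF \<alpha>] cauchy_density_pos[OF assms(2)]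
    by (simp add: cauchy_likelihood_def ln_prod sum_subtractf less_imp_neq[symmetric])
  finally have "ln (cauchy_likelihood n x \<beta>) < ln (cauchy_likelihood n x \<alpha>)"
    by simp
  moreover have "0 < cauchy_likelihood n x \<alpha>" "0 < cauchy_likelihood n x \<beta>"
    using cauchy_density_pos[OF \<alpha>] cauchy_density_pos[OF assms(2)]
    by (auto simp: cauchy_likelihood_def intro!: prod_pos)
  ultimately show ?thesis
    by (simp add: \<alpha>_def e_def)
qed

text \<open>Each point outside the closed disc of radius \<open>t\<close> is beaten by a point on
  its boundary circle, so a maximizer over the compact disc is global and no maximizer lies outside.
  Existence is included because the estimator is only assumed to maximize where a maximizer
  exists.\<close>

lemma cauchy_mle_localization:
  assumes \<theta>: "\<theta> \<in> upper_half_plane" and t: "0 < t" "t < 1"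
    and pos: "\<And>e. norm e = 1 \<Longrightarrow> 0 < (\<Sum>j<n. score (2 * t / (1 + t\<^sup>2)) (cayley_cos \<theta> e (x j)))"
  shows "\<exists>\<alpha>. is_cauchy_mle n x \<alpha>"
    and "is_cauchy_mle n x \<alpha> \<Longrightarrow> norm (cayley \<theta> \<alpha>) \<le> t"
proof -
  have dom: "\<exists>\<gamma>\<in>cayley_inv \<theta> ` cball 0 t. cauchy_likelihood n x \<beta> < cauchy_likelihood n x \<gamma>"
    if \<beta>: "\<beta> \<in> upper_half_plane" "t < norm (cayley \<theta> \<beta>)" for \<beta>
  proof (intro bexI)
    have e: "norm (sgn (cayley \<theta> \<beta>)) = 1"
      using \<beta> t by (auto simp: norm_sgn)
    show "cauchy_likelihood n x \<beta> < cauchy_likelihood n x (cayley_inv \<theta> (of_real t * sgn (cayley \<theta> \<beta>)))"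
      using \<theta> \<beta> t e by (intro cauchy_likelihood_less pos)
    show "cayley_inv \<theta> (of_real t * sgn (cayley \<theta> \<beta>)) \<in> cayley_inv \<theta> ` cball 0 t"
      using e t by (intro imageI) (simp add: norm_mult)
  qed
  have sub: "cayley_inv \<theta> ` cball 0 t \<subseteq> upper_half_plane"
    using \<theta> t by (auto intro!: cayley_inv_upper)
  have "compact (cayley_inv \<theta> ` cball 0 t)"
    unfolding cayley_inv_def using t
    by (intro compact_continuous_image continuous_intros) auto
  moreover have "continuous_on (cayley_inv \<theta> ` cball 0 t) (cauchy_likelihood n x)"
    unfolding cauchy_likelihood_def cauchy_density_def
    by (rule continuous_on_subset[OF _ sub])
      (intro continuous_intros; auto simp: upper_half_plane_def sum_power2_eq_zero_iff)
  moreover have "cayley_inv \<theta> ` cball 0 t \<noteq> {}"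
    using t by simp
  ultimately obtain \<alpha>\<^sub>0 where a: "\<alpha>\<^sub>0 \<in> cayley_inv \<theta> ` cball 0 t"
    "\<And>\<beta>. \<beta> \<in> cayley_inv \<theta> ` cball 0 t \<Longrightarrow> cauchy_likelihood n x \<beta> \<le> cauchy_likelihood n x \<alpha>\<^sub>0"
    using continuous_attains_sup by metis
  have "cauchy_likelihood n x \<beta> \<le> cauchy_likelihood n x \<alpha>\<^sub>0" if "\<beta> \<in> upper_half_plane" for \<beta>
  proof (cases "t < norm (cayley \<theta> \<beta>)")
    case True
    then show ?thesis
      using dom[OF that] a(2) by fastforce
  next
    case False
    then have "\<beta> \<in> cayley_inv \<theta> ` cball 0 t"
      using cayley_inv_cayley[OF \<theta> that] by (intro image_eqI[of _ _ "cayley \<theta> \<beta>"]) auto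
    then show ?thesis by (rule a(2))
  qed
  then show "\<exists>\<alpha>. is_cauchy_mle n x \<alpha>"
    using a(1) sub by (intro exI[of _ \<alpha>\<^sub>0]) (auto simp: is_cauchy_mle_def is_arg_max_def not_less)
  show "norm (cayley \<theta> \<alpha>) \<le> t" if "is_cauchy_mle n x \<alpha>"
    using that dom[of \<alpha>] sub by (fastforce simp: is_cauchy_mle_def is_arg_max_def)
qed

section \<open>Reduction to finitely many directions\<close>

lemma score_net:
  assumes \<theta>: "\<theta> \<in> upper_half_plane" and T: "0 < T" "T < 1" and "0 < \<eta>"
  obtains N where "finite N" "\<And>e. e \<in> N \<Longrightarrow> norm e = 1"
    "\<And>e. norm e = 1 \<Longrightarrow> \<exists>e'\<in>N. \<forall>x. score T (cayley_cos \<theta> e' x) - \<eta> \<le> score T (cayley_cos \<theta> e x)"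
proof -
  \<comment> \<open>The mesh compensates the Lipschitz constant of the score, so that neighbouring
    directions lose at most \<open>\<eta>\<close> per observation.\<close>
  define \<delta> where "\<delta> = \<eta> * (1 - T)\<^sup>2"
  have \<delta>: "0 < \<delta>"
    unfolding \<delta>_def using assms by simp
  have "compact (sphere (0::complex) 1)"
    by simp
  moreover have "sphere (0::complex) 1 \<subseteq> (\<Union>e\<in>sphere 0 1. ball e \<delta>)"
    using \<delta> by auto
  ultimately obtain N where N: "N \<subseteq> sphere 0 1" "finite N" "sphere (0::complex) 1 \<subseteq> (\<Union>e\<in>N. ball e \<delta>)"
    using compactE_image[of "sphere (0::complex) 1" "sphere 0 1" "\<lambda>e. ball e \<delta>"] by auto
  show thesis
  proof (rule that[of N])
    fix e :: complex assume e: "norm e = 1"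
    then obtain e' where e': "e' \<in> N" "dist e' e < \<delta>"
      using N(3) by (auto simp: subset_iff)
    have n': "norm e' = 1"
      using N(1) e'(1) by auto
    have "score T (cayley_cos \<theta> e' x) - \<eta> \<le> score T (cayley_cos \<theta> e x)" for x
    proof -
      have "\<bar>cayley_cos \<theta> e' x - cayley_cos \<theta> e x\<bar> \<le> norm (cnj (e' - e) * cayley \<theta> (of_real x))"
        unfolding cayley_cos_def minus_complex.sel[symmetric]
        by (rule order_trans[OF _ abs_Re_le_cmod]) (simp add: algebra_simps)
      also have "\<dots> < \<delta>"
        unfolding norm_mult complex_mod_cnj using norm_cayley_of_real[OF \<theta>] e'(2) by (simp add: dist_norm)
      finally have "\<bar>cayley_cos \<theta> e' x - cayley_cos \<theta> e x\<bar> / (1 - T)\<^sup>2 \<le> \<delta> / (1 - T)\<^sup>2"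
        using T by (intro divide_right_mono) auto
      also have "\<delta> / (1 - T)\<^sup>2 = \<eta>"
        using T by (simp add: \<delta>_def)
      finally show ?thesis
        using score_lipschitz[OF T abs_cayley_cos_le_1[OF \<theta> n'] abs_cayley_cos_le_1[OF \<theta> e], of x x]
        by linarith
    qed
    then show "\<exists>e'\<in>N. \<forall>x. score T (cayley_cos \<theta> e' x) - \<eta> \<le> score T (cayley_cos \<theta> e x)"
      using e'(1) by blast
  qed (use N in auto)
qed

text \<open>The net is fixed before \<open>n\<close> and the sample, so a union bound over it costs
  a factor independent of \<open>n\<close>.\<close>

lemma cauchy_mle_net:
  assumes \<theta>: "\<theta> \<in> upper_half_plane" and t: "0 < t" "t < 1" and "0 < \<eta>"
  obtains N where "finite N" "\<And>e. e \<in> N \<Longrightarrow> norm e = 1"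
    "\<And>n x. (\<And>e. e \<in> N \<Longrightarrow> 0 < (\<Sum>j<n. score (2 * t / (1 + t\<^sup>2)) (cayley_cos \<theta> e (x j)) - \<eta>)) \<Longrightarrow>
      (\<exists>\<alpha>. is_cauchy_mle n x \<alpha>) \<and>
      (\<forall>\<alpha>. is_cauchy_mle n x \<alpha> \<longrightarrow> norm (\<alpha> - \<theta>) \<le> 2 * Im \<theta> * t / (1 - t))"
proof -
  define T where "T = 2 * t / (1 + t\<^sup>2)"
  have "0 < (1 - t)\<^sup>2"
    using t by simp
  then have "2 * t < 1 + t\<^sup>2"
    by (simp add: power2_eq_square algebra_simps)
  then have T: "0 < T" "T < 1"
    using t by (auto simp: T_def add_pos_nonneg)
  obtain N where N: "finite N" "\<And>e. e \<in> N \<Longrightarrow> norm e = 1"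
    "\<And>e. norm e = 1 \<Longrightarrow> \<exists>e'\<in>N. \<forall>x. score T (cayley_cos \<theta> e' x) - \<eta> \<le> score T (cayley_cos \<theta> e x)"
    using score_net[OF \<theta> T \<open>0 < \<eta>\<close>] by metis
  show thesis
  proof (rule that[OF N(1,2)])
    fix n and x :: "nat \<Rightarrow> real"
    assume *: "\<And>e. e \<in> N \<Longrightarrow> 0 < (\<Sum>j<n. score (2 * t / (1 + t\<^sup>2)) (cayley_cos \<theta> e (x j)) - \<eta>)"
    have pos: "0 < (\<Sum>j<n. score (2 * t / (1 + t\<^sup>2)) (cayley_cos \<theta> e (x j)))" if "norm e = 1" for e
    proof -
      obtain e' where e': "e' \<in> N" "\<And>x. score T (cayley_cos \<theta> e' x) - \<eta> \<le> score T (cayley_cos \<theta> e x)"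
        using N(3)[OF \<open>norm e = 1\<close>] by blast
      have "0 < (\<Sum>j<n. score T (cayley_cos \<theta> e' (x j)) - \<eta>)"
        using *[OF e'(1)] by (simp add: T_def)
      also have "\<dots> \<le> (\<Sum>j<n. score T (cayley_cos \<theta> e (x j)))"
        by (intro sum_mono e'(2))
      finally show ?thesis
        by (simp add: T_def)
    qed
    show "(\<exists>\<alpha>. is_cauchy_mle n x \<alpha>) \<and>
      (\<forall>\<alpha>. is_cauchy_mle n x \<alpha> \<longrightarrow> norm (\<alpha> - \<theta>) \<le> 2 * Im \<theta> * t / (1 - t))"
    proof (intro conjI allI impI)
      show "\<exists>\<alpha>. is_cauchy_mle n x \<alpha>"
        using \<theta> t pos by (rule cauchy_mle_localization)
      fix \<alpha> assume a: "is_cauchy_mle n x \<alpha>"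
      then have "norm (cayley \<theta> \<alpha>) \<le> t"
        using cauchy_mle_localization(2)[OF \<theta> t pos] by blast
      moreover have "\<alpha> \<in> upper_half_plane"
        using a by (simp add: is_cauchy_mle_def is_arg_max_def)
      ultimately show "norm (\<alpha> - \<theta>) \<le> 2 * Im \<theta> * t / (1 - t)"
        using norm_cayley_inv_diff_le[OF \<theta> _ t(2), of "cayley \<theta> \<alpha>"] cayley_inv_cayley[OF \<theta>, of \<alpha>] by simp
    qed
  qed
qed

lemma borel_measurable_score [measurable]: "score T \<in> borel_measurable borel"
  unfolding score_def by measurable

section \<open>Exponential moments\<close>

text \<open>The score has mean about T/2 and variance about 1/2, so the Chernoff parameter
  minimizing the second-order expansion is their quotient \<open>T\<close>, and the exponent is
  about \<open>- T\<^sup>2 / 4\<close>. The subtracted \<open>T\<^sup>2\<close> is the slack for the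
  net.\<close>

lemma cauchy_integral_exp_score_le:
  assumes \<theta>: "\<theta> \<in> upper_half_plane" and e: "norm e = 1" and T: "0 < T" "T \<le> 1/2"
  shows "(\<integral>x. cauchy_density \<theta> x * exp (- T * (score T (cayley_cos \<theta> e x) - T\<^sup>2)) \<partial>lborel)
    \<le> exp (- T\<^sup>2 / 4 + 7 * T ^ 3)"
proof -
  have c: "\<bar>cayley_cos \<theta> e x\<bar> \<le> 1" for x
    using \<theta> e by (rule abs_cayley_cos_le_1)
  have g: "\<bar>score T (cayley_cos \<theta> e x)\<bar> \<le> 1" for x
    using T c by (intro abs_score_le_1) auto
  have "\<bar>T * score T (cayley_cos \<theta> e x)\<bar> \<le> 1" for x
    unfolding abs_mult using g[of x] T by (intro mult_le_one) auto
  then have bd: "norm (exp (- T * score T (cayley_cos \<theta> e x))) \<le> exp 1" for x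
    by (simp add: abs_le_iff minus_le_iff)
  have I1: "integrable lborel (\<lambda>x. cauchy_density \<theta> x * exp (- T * score T (cayley_cos \<theta> e x)))"
    using integrable_cauchy_density_scaleR[OF \<theta> _ bd] by simp
  have I2: "integrable lborel (\<lambda>x. cauchy_density \<theta> x * cayley_cos \<theta> e x)"
    using integrable_cauchy_density_scaleR[OF \<theta>, of "cayley_cos \<theta> e" 1] c by simp
  have I3: "integrable lborel (\<lambda>x. cauchy_density \<theta> x * (cayley_cos \<theta> e x)\<^sup>2)"
    using integrable_cauchy_density_scaleR[OF \<theta>, of "\<lambda>x. (cayley_cos \<theta> e x)\<^sup>2" 1] c
    by (simp add: abs_square_le_1)
  note I0 = cauchy_density_integral[OF \<theta>]
  have "(\<integral>x. cauchy_density \<theta> x * exp (- T * score T (cayley_cos \<theta> e x)) \<partial>lborel)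
      \<le> (\<integral>x. (1 - T\<^sup>2 + 6 * T ^ 3) * cauchy_density \<theta> x + T * (cauchy_density \<theta> x * cayley_cos \<theta> e x)
         + 3/2 * T\<^sup>2 * (cauchy_density \<theta> x * (cayley_cos \<theta> e x)\<^sup>2) \<partial>lborel)"
  proof (rule integral_mono[OF I1])
    fix x
    have "cauchy_density \<theta> x * exp (- T * score T (cayley_cos \<theta> e x)) \<le> cauchy_density \<theta> x *
        (1 - T\<^sup>2 + T * cayley_cos \<theta> e x + 3/2 * T\<^sup>2 * (cayley_cos \<theta> e x)\<^sup>2 + 6 * T ^ 3)"
      using cauchy_density_pos[OF \<theta>, of x] T c by (intro mult_left_mono exp_score_le) auto
    then show "cauchy_density \<theta> x * exp (- T * score T (cayley_cos \<theta> e x))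
      \<le> (1 - T\<^sup>2 + 6 * T ^ 3) * cauchy_density \<theta> x + T * (cauchy_density \<theta> x * cayley_cos \<theta> e x)
         + 3/2 * T\<^sup>2 * (cauchy_density \<theta> x * (cayley_cos \<theta> e x)\<^sup>2)"
      by (simp add: algebra_simps)
  qed (use I0 I2 I3 in simp)
  \<comment> \<open>The second moment 1/2 turns the quadratic part into -1 + 3/2 * 1/2 = -1/4 times
    \<open>T\<^sup>2\<close>.\<close>
  also have "\<dots> = 1 + (- T\<^sup>2 / 4 + 6 * T ^ 3)"
    using I0 I2 I3 by (simp add: cauchy_moment_cayley_cos[OF \<theta> e])
  also have "\<dots> \<le> exp (- T\<^sup>2 / 4 + 6 * T ^ 3)"
    by (rule exp_ge_add_one_self)
  \<comment> \<open>The slack \<open>T\<^sup>2\<close>, multiplied by the Chernoff parameter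
    \<open>T\<close>, costs the factor \<open>exp (T ^ 3)\<close> and raises the cubic constant from
    6 to 7.\<close>
  finally have "exp (T ^ 3) * (\<integral>x. cauchy_density \<theta> x * exp (- T * score T (cayley_cos \<theta> e x)) \<partial>lborel)
      \<le> exp (T ^ 3) * exp (- T\<^sup>2 / 4 + 6 * T ^ 3)"
    by (intro mult_left_mono) auto
  also have "\<dots> = exp (- T\<^sup>2 / 4 + 7 * T ^ 3)"
    unfolding exp_add[symmetric] by simp
  also have "exp (T ^ 3) * (\<integral>x. cauchy_density \<theta> x * exp (- T * score T (cayley_cos \<theta> e x)) \<partial>lborel)
      = (\<integral>x. exp (T ^ 3) * (cauchy_density \<theta> x * exp (- T * score T (cayley_cos \<theta> e x))) \<partial>lborel)"
    by (rule integral_mult_right_zero[symmetric])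
  also have "\<dots> = (\<integral>x. cauchy_density \<theta> x * exp (- T * (score T (cayley_cos \<theta> e x) - T\<^sup>2)) \<partial>lborel)"
    by (intro Bochner_Integration.integral_cong refl)
      (simp add: exp_diff exp_minus right_diff_distrib power3_eq_cube power2_eq_square field_simps flip: exp_add)
  finally show ?thesis .
qed

text \<open>As a function of \<open>l\<close> the integral is 1 at 0 with slope minus the mean,
  hence drops below 1 for small positive \<open>l\<close>; the bound \<open>B\<close> makes this
  quantitative.\<close>

lemma cauchy_exp_moment_less_1:
  assumes \<theta>: "\<theta> \<in> upper_half_plane" and [measurable]: "f \<in> borel_measurable borel"
    and f: "\<And>x. \<bar>f x\<bar> \<le> B" and m: "0 < (\<integral>x. cauchy_density \<theta> x * f x \<partial>lborel)"
  shows "\<exists>l>0. (\<integral>x. cauchy_density \<theta> x * exp (- l * f x) \<partial>lborel) < 1"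
proof -
  define m where "m = (\<integral>x. cauchy_density \<theta> x * f x \<partial>lborel)"
  have I: "integrable lborel (\<lambda>x. cauchy_density \<theta> x * f x)"
    using integrable_cauchy_density_scaleR[OF \<theta>, of f B] f by simp
  note I0 = cauchy_density_integral[OF \<theta>]
  have "m \<le> (\<integral>x. B * cauchy_density \<theta> x \<partial>lborel)"
    unfolding m_def
  proof (rule integral_mono[OF I])
    show "cauchy_density \<theta> x * f x \<le> B * cauchy_density \<theta> x" for x
      using f[of x] cauchy_density_pos[OF \<theta>, of x] by (simp add: mult.commute mult_right_mono)
  qed (use I0 in simp)
  then have mB: "m \<le> B"
    using I0 by simp
  have m0: "0 < m" using m by (simp add: m_def)
  with mB have B: "0 < B" by simp
  \<comment> \<open>This choice makes the quadratic error 3/4 of the linear gain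
    \<open>l * m\<close>, and \<open>m \<le> B\<close> keeps the exponents within 1/2.\<close>
  define l where "l = m / (2 * B\<^sup>2)"
  have l: "0 < l" "l * B \<le> 1/2"
    using m0 mB B by (auto simp: l_def power2_eq_square)
  have y: "\<bar>- l * f x\<bar> \<le> 1/2" for x
  proof -
    have "l * \<bar>f x\<bar> \<le> l * B"
      using l f[of x] by simp
    moreover have "\<bar>- l * f x\<bar> = l * \<bar>f x\<bar>"
      using l by (simp add: abs_mult)
    ultimately show ?thesis
      using l by linarith
  qed
  have ex: "exp (- l * f x) \<le> 1 - l * f x + 3/2 * (l\<^sup>2 * B\<^sup>2)" for x
  proof -
    define z where "z = - l * f x"
    obtain s where s: "\<bar>s\<bar> \<le> \<bar>z\<bar>" "exp z = (\<Sum>m<2. z ^ m / fact m) + exp s / fact 2 * z ^ 2"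
      using Maclaurin_exp_le[of z 2] by blast
    have "s \<le> 1"
      using s(1) y[of x] by (simp add: z_def)
    then have "exp s \<le> 3"
      using exp_le exp_le_cancel_iff[of s 1] by linarith
    moreover have "z\<^sup>2 \<le> l\<^sup>2 * B\<^sup>2"
      unfolding z_def power_mult_distrib using f[of x] power_mono[of "\<bar>f x\<bar>" B 2]
      by (simp add: mult_left_mono)
    ultimately have "exp s * z\<^sup>2 \<le> 3 * (l\<^sup>2 * B\<^sup>2)"
      by (intro mult_mono) auto
    then show ?thesis
      using s(2) by (simp add: eval_nat_numeral z_def)
  qed
  have le1: "norm (exp (- l * f x)) \<le> exp 1" for x
    using y[of x] by simp
  have "(\<integral>x. cauchy_density \<theta> x * exp (- l * f x) \<partial>lborel)
      \<le> (\<integral>x. (1 + 3/2 * (l\<^sup>2 * B\<^sup>2)) * cauchy_density \<theta> x - l * (cauchy_density \<theta> x * f x) \<partial>lborel)"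
  proof (rule integral_mono)
    show "integrable lborel (\<lambda>x. cauchy_density \<theta> x * exp (- l * f x))"
      using integrable_cauchy_density_scaleR[OF \<theta> _ le1] by simp
    fix x
    show "cauchy_density \<theta> x * exp (- l * f x) \<le>
        (1 + 3/2 * (l\<^sup>2 * B\<^sup>2)) * cauchy_density \<theta> x - l * (cauchy_density \<theta> x * f x)"
      using mult_left_mono[OF ex[of x] less_imp_le[OF cauchy_density_pos[OF \<theta>, of x]]]
      by (simp add: algebra_simps)
  qed (use I I0 in simp)
  also have "\<dots> = 1 + 3/2 * (l\<^sup>2 * B\<^sup>2) - l * m"
    using I I0 by (simp add: m_def)
  also have "l\<^sup>2 * B\<^sup>2 = l * (m / 2)"
    using B by (simp add: l_def power2_eq_square)
  also have "1 + 3/2 * (l * (m / 2)) - l * m < 1"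
    using l m0 by simp
  finally show ?thesis
    using l by blast
qed

section \<open>Change of measure\<close>

text \<open>A boundary point of the disc has distance between \<open>1 - \<rho>\<close> and 2 from a
  fixed interior point of modulus \<open>\<rho>\<close>, so the Poisson kernel is bounded away from
  0 and infinity. Bounded log ratios have all exponential moments.\<close>

lemma cauchy_density_ratio_bounds:
  assumes "\<theta> \<in> upper_half_plane" "\<alpha> \<in> upper_half_plane"
  obtains B where "\<And>x. \<bar>ln (cauchy_density \<alpha> x / cauchy_density \<theta> x)\<bar> \<le> B"
proof -
  define \<rho> where "\<rho> = norm (cayley \<theta> \<alpha>)"
  have \<rho>: "0 \<le> \<rho>" "\<rho> < 1"
    unfolding \<rho>_def using norm_cayley_less_1[OF assms] by auto
  define B where "B = \<bar>ln (1 - \<rho>\<^sup>2)\<bar> + 2 * \<bar>ln (1 - \<rho>)\<bar> + 2 * ln 2"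
  have "0 < ln (2::real)"
    by simp
  have "\<bar>ln (cauchy_density \<alpha> x / cauchy_density \<theta> x)\<bar> \<le> B" for x
  proof -
    define d where "d = norm (cayley \<theta> (of_real x) - cayley \<theta> \<alpha>)"
    have d: "1 - \<rho> \<le> d" "d \<le> 2"
      using norm_triangle_ineq2[of "cayley \<theta> (of_real x)" "cayley \<theta> \<alpha>"]
        norm_triangle_ineq4[of "cayley \<theta> (of_real x)" "cayley \<theta> \<alpha>"] \<rho> norm_cayley_of_real[OF assms(1), of x]
      by (auto simp: d_def \<rho>_def)
    then have "ln (1 - \<rho>) \<le> ln d" "ln d \<le> ln 2"
      using \<rho> by (auto intro!: ln_mono)
    moreover have "0 < 1 - \<rho>\<^sup>2"
      using \<rho> by (simp add: abs_square_less_1)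
    then have "ln (cauchy_density \<alpha> x / cauchy_density \<theta> x) = ln (1 - \<rho>\<^sup>2) - 2 * ln d"
      unfolding cauchy_density_ratio[OF assms] \<rho>_def[symmetric] d_def[symmetric]
      using d \<rho> by (simp add: ln_div ln_realpow)
    ultimately show ?thesis
      using \<open>0 < ln 2\<close> unfolding B_def by linarith
  qed
  then show thesis
    by (rule that)
qed

section \<open>Independent samples and reweighted expectations\<close>

locale cauchy_sample = prob_space M for M :: "'a measure" +
  fixes X :: "nat \<Rightarrow> 'a \<Rightarrow> real" and \<theta> :: complex
  assumes upper: "\<theta> \<in> upper_half_plane"
    and indep: "indep_vars (\<lambda>_. borel) X UNIV"
    and distr: "\<And>j. distributed M lborel (X j) (\<lambda>x. ennreal (cauchy_density \<theta> x))"
begin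

lemma measurable_sample [measurable]: "X j \<in> borel_measurable M"
  using distributed_measurable[OF distr] by simp

lemma
  fixes \<phi> :: "real \<Rightarrow> real"
  assumes [measurable]: "\<phi> \<in> borel_measurable borel" and "\<And>x. \<bar>\<phi> x\<bar> \<le> B"
  shows integrable_prod_sample: "integrable M (\<lambda>\<omega>. \<Prod>j<n. \<phi> (X j \<omega>))"
    and expectation_prod_sample:
      "expectation (\<lambda>\<omega>. \<Prod>j<n. \<phi> (X j \<omega>)) = (\<integral>x. cauchy_density \<theta> x * \<phi> x \<partial>lborel) ^ n"
proof -
  have ind: "indep_vars (\<lambda>_. borel) (\<lambda>j \<omega>. \<phi> (X j \<omega>)) {..<n}"
    by (rule indep_vars_compose2[OF indep_vars_subset[OF indep]]) auto
  have int: "integrable M (\<lambda>\<omega>. \<phi> (X j \<omega>))" for j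
    by (rule integrable_const_bound[where B=B]) (use assms(2) in auto)
  have E: "expectation (\<lambda>\<omega>. \<phi> (X j \<omega>)) = (\<integral>x. cauchy_density \<theta> x * \<phi> x \<partial>lborel)" for j
    using distr upper by (intro distributed_integral[symmetric]) (auto intro: less_imp_le cauchy_density_pos)
  show "integrable M (\<lambda>\<omega>. \<Prod>j<n. \<phi> (X j \<omega>))"
    using ind int by (intro indep_vars_integrable) auto
  show "expectation (\<lambda>\<omega>. \<Prod>j<n. \<phi> (X j \<omega>)) = (\<integral>x. cauchy_density \<theta> x * \<phi> x \<partial>lborel) ^ n"
    using ind int by (subst indep_vars_lebesgue_integral) (auto simp: E)
qed

text \<open>Weighting with this ratio turns expectations under \<open>\<theta>\<close> into expectations under \<open>\<theta>'\<close>, so no product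
  measure for \<open>\<theta>'\<close> is needed.\<close>

definition likelihood_ratio :: "complex \<Rightarrow> nat \<Rightarrow> 'a \<Rightarrow> real" where
  "likelihood_ratio \<theta>' n \<omega> = (\<Prod>j<n. cauchy_density \<theta>' (X j \<omega>) / cauchy_density \<theta> (X j \<omega>))"

lemma likelihood_ratio_pos:
  assumes "\<theta>' \<in> upper_half_plane"
  shows "0 < likelihood_ratio \<theta>' n \<omega>"
  using upper assms unfolding likelihood_ratio_def
  by (intro prod_pos) (simp add: cauchy_density_pos)

text \<open>The weighted exponential is a product of one function of each observation, so
  independence factorizes it, and in every factor the density at \<open>\<theta>\<close> cancels.
  \<open>f = 0\<close> gives total mass 1, and a negative multiple of \<open>f\<close> gives
  Chernoff bounds.\<close>

lemma likelihood_ratio_integral: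
  assumes \<theta>': "\<theta>' \<in> upper_half_plane"
    and [measurable]: "f \<in> borel_measurable borel" and f: "\<And>x. \<bar>f x\<bar> \<le> B"
  shows "integrable M (\<lambda>\<omega>. likelihood_ratio \<theta>' n \<omega> * exp (\<Sum>j<n. f (X j \<omega>)))"
    and "expectation (\<lambda>\<omega>. likelihood_ratio \<theta>' n \<omega> * exp (\<Sum>j<n. f (X j \<omega>))) =
      (\<integral>x. cauchy_density \<theta>' x * exp (f x) \<partial>lborel) ^ n"
proof -
  define \<phi> where "\<phi> x = cauchy_density \<theta>' x / cauchy_density \<theta> x * exp (f x)" for x
  have [measurable]: "\<phi> \<in> borel_measurable borel"
    unfolding \<phi>_def by measurable
  obtain C where C: "\<And>x. \<bar>ln (cauchy_density \<theta>' x / cauchy_density \<theta> x)\<bar> \<le> C"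
    using cauchy_density_ratio_bounds[OF upper \<theta>'] by metis
  have b: "\<bar>\<phi> x\<bar> \<le> exp (C + B)" for x
  proof -
    have p: "0 < cauchy_density \<theta>' x / cauchy_density \<theta> x"
      using upper \<theta>' by (simp add: cauchy_density_pos)
    then have "\<phi> x = exp (ln (cauchy_density \<theta>' x / cauchy_density \<theta> x) + f x)"
      by (simp add: \<phi>_def exp_add)
    then show ?thesis
      using C[of x] f[of x] by (simp add: abs_le_iff)
  qed
  have eq: "likelihood_ratio \<theta>' n \<omega> * exp (\<Sum>j<n. f (X j \<omega>)) = (\<Prod>j<n. \<phi> (X j \<omega>))" for \<omega>
    by (simp only: likelihood_ratio_def \<phi>_def prod.distrib exp_sum finite_lessThan)
  have p\<phi>: "cauchy_density \<theta> x * \<phi> x = cauchy_density \<theta>' x * exp (f x)" for x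
    using cauchy_density_pos[OF upper, of x] by (simp add: \<phi>_def)
  show "integrable M (\<lambda>\<omega>. likelihood_ratio \<theta>' n \<omega> * exp (\<Sum>j<n. f (X j \<omega>)))"
    unfolding eq by (rule integrable_prod_sample[OF _ b]) measurable
  show "expectation (\<lambda>\<omega>. likelihood_ratio \<theta>' n \<omega> * exp (\<Sum>j<n. f (X j \<omega>))) =
      (\<integral>x. cauchy_density \<theta>' x * exp (f x) \<partial>lborel) ^ n"
    unfolding eq by (subst expectation_prod_sample[OF _ b]) (auto simp: p\<phi>)
qed

lemma borel_measurable_likelihood_ratio [measurable]: "likelihood_ratio \<theta>' n \<in> borel_measurable M"
  unfolding likelihood_ratio_def by measurable

lemma likelihood_ratio_expectation:
  assumes "\<theta>' \<in> upper_half_plane"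
  shows "integrable M (likelihood_ratio \<theta>' n)" "expectation (likelihood_ratio \<theta>' n) = 1"
  using likelihood_ratio_integral[OF assms, of "\<lambda>_. 0" 0 n] cauchy_density_integral[OF assms] by auto

text \<open>Makes ordinary probabilities the case \<open>\<theta>' = \<theta>\<close> of the
  weighted bounds.\<close>

lemma likelihood_ratio_self: "likelihood_ratio \<theta> n \<omega> = 1"
  using upper by (simp add: likelihood_ratio_def cauchy_density_pos less_imp_neq[symmetric])

text \<open>Chernoff's bound under \<open>\<theta>'\<close>: the indicator is dominated by the
  exponential of \<open>- l\<close> times the sum, inside the weighted expectation.\<close>

lemma likelihood_ratio_chernoff:
  assumes \<theta>': "\<theta>' \<in> upper_half_plane" and f_meas [measurable]: "f \<in> borel_measurable borel"
    and f: "\<And>x. \<bar>f x\<bar> \<le> B" and l: "0 \<le> l"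
  shows "expectation (\<lambda>\<omega>. likelihood_ratio \<theta>' n \<omega> * indicator {\<omega>. (\<Sum>j<n. f (X j \<omega>)) \<le> 0} \<omega>)
    \<le> (\<integral>x. cauchy_density \<theta>' x * exp (- l * f x) \<partial>lborel) ^ n"
proof -
  have lf: "\<bar>- l * f x\<bar> \<le> l * B" for x
    using l f[of x] by (simp add: abs_mult mult_left_mono)
  have "expectation (\<lambda>\<omega>. likelihood_ratio \<theta>' n \<omega> * indicator {\<omega>. (\<Sum>j<n. f (X j \<omega>)) \<le> 0} \<omega>)
      \<le> expectation (\<lambda>\<omega>. likelihood_ratio \<theta>' n \<omega> * exp (\<Sum>j<n. - l * f (X j \<omega>)))"
  proof (rule integral_mono)
    show "integrable M (\<lambda>\<omega>. likelihood_ratio \<theta>' n \<omega> * indicator {\<omega>. (\<Sum>j<n. f (X j \<omega>)) \<le> 0} \<omega>)"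
      using likelihood_ratio_pos[OF \<theta>', of n]
      by (intro Bochner_Integration.integrable_bound[OF likelihood_ratio_expectation(1)[OF \<theta>', of n]])
        (auto simp: indicator_def)
    show "integrable M (\<lambda>\<omega>. likelihood_ratio \<theta>' n \<omega> * exp (\<Sum>j<n. - l * f (X j \<omega>)))"
      by (rule likelihood_ratio_integral(1)[OF \<theta>' _ lf]) measurable
    fix \<omega>
    have "1 \<le> exp (\<Sum>j<n. - l * f (X j \<omega>))" if "(\<Sum>j<n. f (X j \<omega>)) \<le> 0"
      using that l by (simp add: sum_negf sum_distrib_left[symmetric] mult_nonneg_nonpos)
    then show "likelihood_ratio \<theta>' n \<omega> * indicator {\<omega>. (\<Sum>j<n. f (X j \<omega>)) \<le> 0} \<omega>
        \<le> likelihood_ratio \<theta>' n \<omega> * exp (\<Sum>j<n. - l * f (X j \<omega>))"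
      using likelihood_ratio_pos[OF \<theta>', of n \<omega>] by (auto simp: indicator_def)
  qed
  also have "\<dots> = (\<integral>x. cauchy_density \<theta>' x * exp (- l * f x) \<partial>lborel) ^ n"
    by (rule likelihood_ratio_integral(2)[OF \<theta>' _ lf]) measurable
  finally show ?thesis .
qed

end

section \<open>Deviation probabilities of the estimator\<close>

text \<open>At distance d the scale of \<open>\<theta>'\<close> is at most
  \<open>Im \<theta>\<close> + d, and d^2 / (\<open>Im \<theta>\<close> + d) increases with d. This
  keeps the divergence away from 0 outside the ball, so \<open>cauchy_b\<close> is positive and may
  be divided by.\<close>

lemma cauchy_KL_ge:
  assumes \<theta>: "\<theta> \<in> upper_half_plane" and \<theta>': "\<theta>' \<in> upper_half_plane"
    and \<epsilon>: "0 < \<epsilon>" "\<epsilon> < cmod (\<theta>' - \<theta>)"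
  shows "ln (1 + \<epsilon>\<^sup>2 / (4 * Im \<theta> * (Im \<theta> + \<epsilon>))) \<le> cauchy_KL \<theta>' \<theta>"
proof -
  define d where "d = cmod (\<theta>' - \<theta>)"
  have p: "0 < Im \<theta>" "0 < Im \<theta>'"
    using \<theta> \<theta>' by (auto simp: upper_half_plane_def)
  have d: "\<epsilon> < d" "0 < d"
    using \<epsilon> by (auto simp: d_def)
  have "Im \<theta>' \<le> Im \<theta> + d"
    using abs_Im_le_cmod[of "\<theta>' - \<theta>"] by (simp add: d_def)
  have "\<epsilon>\<^sup>2 * (Im \<theta> + d) \<le> d\<^sup>2 * (Im \<theta> + \<epsilon>)"
  proof -
    have "\<epsilon>\<^sup>2 * Im \<theta> \<le> d\<^sup>2 * Im \<theta>"
      using d \<epsilon> p by (intro mult_right_mono power_mono) auto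
    moreover have "\<epsilon> * (\<epsilon> * d) \<le> d * (\<epsilon> * d)"
      using d \<epsilon> by (intro mult_right_mono) auto
    ultimately show ?thesis
      by (simp add: algebra_simps power2_eq_square)
  qed
  then have "\<epsilon>\<^sup>2 / (Im \<theta> + \<epsilon>) \<le> d\<^sup>2 / (Im \<theta> + d)"
    using d \<epsilon> p by (simp add: field_simps)
  also have "\<dots> \<le> d\<^sup>2 / Im \<theta>'"
    using p d \<open>Im \<theta>' \<le> Im \<theta> + d\<close> by (intro divide_left_mono) auto
  finally have "\<epsilon>\<^sup>2 / (Im \<theta> + \<epsilon>) / (4 * Im \<theta>) \<le> d\<^sup>2 / Im \<theta>' / (4 * Im \<theta>)"
    using p by (intro divide_right_mono) auto
  then have "\<epsilon>\<^sup>2 / (4 * Im \<theta> * (Im \<theta> + \<epsilon>)) \<le> d\<^sup>2 / (4 * Im \<theta> * Im \<theta>')"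
    by (simp add: mult_ac)
  moreover have "0 \<le> \<epsilon>\<^sup>2 / (4 * Im \<theta> * (Im \<theta> + \<epsilon>))"
    using p \<epsilon> by simp
  ultimately show ?thesis
    unfolding cauchy_KL_eq_ln[OF \<theta> \<theta>'] d_def[symmetric] by simp
qed

lemma cauchy_b_bounds:
  assumes \<theta>: "\<theta> \<in> upper_half_plane" and \<epsilon>: "0 < \<epsilon>"
  shows "0 < cauchy_b \<epsilon> \<theta>" "cauchy_b \<epsilon> \<theta> \<le> \<epsilon>\<^sup>2 / (4 * (Im \<theta>)\<^sup>2)"
    and "cauchy_b \<epsilon> \<theta> < c \<Longrightarrow> \<exists>\<theta>'\<in>upper_half_plane. \<epsilon> < cmod (\<theta>' - \<theta>) \<and> cauchy_KL \<theta>' \<theta> < c"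
proof -
  define S where "S = {\<theta>' \<in> upper_half_plane. \<epsilon> < cmod (\<theta>' - \<theta>)}"
  define l where "l = ln (1 + \<epsilon>\<^sup>2 / (4 * Im \<theta> * (Im \<theta> + \<epsilon>)))"
  have p: "0 < Im \<theta>"
    using \<theta> by (auto simp: upper_half_plane_def)
  have l: "l \<le> cauchy_KL \<theta>' \<theta>" if "\<theta>' \<in> S" for \<theta>'
    unfolding l_def using that \<theta> \<epsilon> by (intro cauchy_KL_ge) (auto simp: S_def)
  \<comment> \<open>Vertical displacements upwards never leave the half plane, whatever
    \<open>\<epsilon>\<close> is, and serve as test points for the infimum.\<close>
  have vert: "\<theta> + of_real s * \<i> \<in> S" if "\<epsilon> < s" for s
    using that p \<epsilon> by (auto simp: S_def upper_half_plane_def norm_mult)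
  have ne: "S \<noteq> {}"
    using vert[of "\<epsilon> + 1"] by auto
  have bdd: "bdd_below ((\<lambda>\<theta>'. cauchy_KL \<theta>' \<theta>) ` S)"
    using l by (intro bdd_belowI2)
  have b: "cauchy_b \<epsilon> \<theta> = (INF \<theta>'\<in>S. cauchy_KL \<theta>' \<theta>)"
    by (simp add: cauchy_b_def S_def)
  have "0 < \<epsilon>\<^sup>2 / (4 * Im \<theta> * (Im \<theta> + \<epsilon>))"
    using p \<epsilon> by (intro divide_pos_pos mult_pos_pos add_pos_pos) auto
  then have "0 < l"
    unfolding l_def by (intro ln_gt_zero) simp
  also have "l \<le> cauchy_b \<epsilon> \<theta>"
    unfolding b using ne l by (rule cINF_greatest)
  finally show "0 < cauchy_b \<epsilon> \<theta>" .
  show "\<exists>\<theta>'\<in>upper_half_plane. \<epsilon> < cmod (\<theta>' - \<theta>) \<and> cauchy_KL \<theta>' \<theta> < c" if "cauchy_b \<epsilon> \<theta> < c"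
    using that unfolding b by (subst (asm) cINF_less_iff[OF ne bdd]) (auto simp: S_def)
  have "cauchy_b \<epsilon> \<theta> \<le> s\<^sup>2 / (4 * (Im \<theta>)\<^sup>2)" if s: "\<epsilon> < s" for s
  proof -
    have "cauchy_b \<epsilon> \<theta> \<le> cauchy_KL (\<theta> + of_real s * \<i>) \<theta>"
      unfolding b using bdd vert[OF s] by (rule cINF_lower)
    also have "\<dots> = ln (1 + s\<^sup>2 / (4 * Im \<theta> * (Im \<theta> + s)))"
      using \<theta> vert[OF s] s \<epsilon> by (subst cauchy_KL_eq_ln) (auto simp: S_def norm_mult)
    also have "\<dots> \<le> s\<^sup>2 / (4 * Im \<theta> * (Im \<theta> + s))"
      using p s \<epsilon> by (intro ln_add_one_self_le_self) simp
    also have "\<dots> \<le> s\<^sup>2 / (4 * Im \<theta> * Im \<theta>)"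
      using p s \<epsilon> by (intro divide_left_mono mult_left_mono) auto
    finally show ?thesis
      by (simp add: power2_eq_square)
  qed
  \<comment> \<open>The strict inequality in the infimum excludes \<open>s = \<epsilon>\<close>, so
    the bound is obtained as a limit from the right.\<close>
  then have "eventually (\<lambda>s. cauchy_b \<epsilon> \<theta> \<le> s\<^sup>2 / (4 * (Im \<theta>)\<^sup>2)) (at_right \<epsilon>)"
    by (auto simp: eventually_at_filter)
  moreover have "((\<lambda>s. s\<^sup>2 / (4 * (Im \<theta>)\<^sup>2)) \<longlongrightarrow> \<epsilon>\<^sup>2 / (4 * (Im \<theta>)\<^sup>2)) (at_right \<epsilon>)"
    using p by (intro tendsto_intros) auto
  ultimately show "cauchy_b \<epsilon> \<theta> \<le> \<epsilon>\<^sup>2 / (4 * (Im \<theta>)\<^sup>2)"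
    by (intro tendsto_lowerbound) auto
qed

text \<open>The maximizing property is conditional because degenerate samples, for instance with all
  observations equal, have unbounded likelihood. Existence on the relevant event comes from the
  localization.\<close>

locale cauchy_mle = cauchy_sample +
  fixes \<theta>hat :: "nat \<Rightarrow> 'a \<Rightarrow> complex"
  assumes measurable_mle [measurable]: "\<theta>hat n \<in> borel_measurable M"
    and mle: "3 \<le> n \<Longrightarrow> AE \<omega> in M. (\<exists>\<alpha>. is_cauchy_mle n (\<lambda>j. X j \<omega>) \<alpha>) \<longrightarrow>
                 is_cauchy_mle n (\<lambda>j. X j \<omega>) (\<theta>hat n \<omega>)"
begin

text \<open>Union bound over the net: a deviation forces the shifted score sum to be nonpositive in
  some direction, and each such event obeys the Chernoff bound; \<open>K\<close> is the size of the
  net. General \<open>\<theta>'\<close> is kept since the bound serves both under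
  \<open>\<theta>\<close> and under the alternative.\<close>

lemma likelihood_ratio_mle_deviation_le:
  assumes \<theta>': "\<theta>' \<in> upper_half_plane" and t: "0 < t" "t < 1"
    and T: "T = 2 * t / (1 + t\<^sup>2)" "T \<le> 1/2"
    and r: "2 * Im \<theta>' * t / (1 - t) \<le> r"
  shows "\<exists>K. \<forall>n\<ge>3. expectation (\<lambda>\<omega>. likelihood_ratio \<theta>' n \<omega> *
      indicator {\<omega>. r < cmod (\<theta>hat n \<omega> - \<theta>')} \<omega>) \<le> K * exp (- T\<^sup>2 / 4 + 7 * T ^ 3) ^ n"
proof -
  have T0: "0 < T"
    unfolding T(1) using t by (simp add: add_pos_nonneg)
  \<comment> \<open>The slack \<open>T\<^sup>2\<close> is of smaller order than the mean score,
    about T/2, and so affects only the cubic term of the exponent.\<close>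
  obtain N where N: "finite N" "\<And>e. e \<in> N \<Longrightarrow> norm e = 1"
    "\<And>n x. (\<And>e. e \<in> N \<Longrightarrow> 0 < (\<Sum>j<n. score T (cayley_cos \<theta>' e (x j)) - T\<^sup>2)) \<Longrightarrow>
      (\<exists>\<alpha>. is_cauchy_mle n x \<alpha>) \<and>
      (\<forall>\<alpha>. is_cauchy_mle n x \<alpha> \<longrightarrow> norm (\<alpha> - \<theta>') \<le> 2 * Im \<theta>' * t / (1 - t))"
    using cauchy_mle_net[OF \<theta>' t, of "T\<^sup>2"] T0 unfolding T(1)[symmetric] by (metis zero_less_power)
  define f where "f e x = score T (cayley_cos \<theta>' e x) - T\<^sup>2" for e x
  have f_meas [measurable]: "f e \<in> borel_measurable borel" for e
    unfolding f_def by measurable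
  have f: "\<bar>f e x\<bar> \<le> 2" if "e \<in> N" for e x
  proof -
    have "\<bar>score T (cayley_cos \<theta>' e x)\<bar> \<le> 1"
      using T0 T(2) abs_cayley_cos_le_1[OF \<theta>' N(2)[OF that]] by (intro abs_score_le_1) auto
    moreover have "T\<^sup>2 \<le> 1"
      using T0 T(2) by (simp add: power_le_one)
    ultimately show ?thesis
      unfolding f_def using zero_le_power2[of T] by linarith
  qed
  let ?bad = "\<lambda>n e \<omega>. likelihood_ratio \<theta>' n \<omega> * indicator {\<omega>. (\<Sum>j<n. f e (X j \<omega>)) \<le> 0} \<omega>"
  have bad: "expectation (?bad n e) \<le> exp (- T\<^sup>2 / 4 + 7 * T ^ 3) ^ n" if "e \<in> N" for n e
  proof -
    have "expectation (?bad n e) \<le> (\<integral>x. cauchy_density \<theta>' x * exp (- T * f e x) \<partial>lborel) ^ n"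
      using T0 by (intro likelihood_ratio_chernoff[OF \<theta>' f_meas f[OF that]]) simp
    also have "\<dots> \<le> exp (- T\<^sup>2 / 4 + 7 * T ^ 3) ^ n"
      using cauchy_integral_exp_score_le[OF \<theta>' N(2)[OF that] T0 T(2)] cauchy_density_pos[OF \<theta>']
      unfolding f_def
      by (intro power_mono integral_nonneg_AE AE_I2 mult_nonneg_nonneg) (auto intro: less_imp_le)
    finally show ?thesis .
  qed
  have int_bad: "integrable M (\<lambda>\<omega>. likelihood_ratio \<theta>' n \<omega> * indicator A \<omega>)"
    if [measurable]: "{\<omega>\<in>space M. \<omega> \<in> A} \<in> sets M" for n A
    using likelihood_ratio_pos[OF \<theta>', of n]
    by (intro Bochner_Integration.integrable_bound[OF likelihood_ratio_expectation(1)[OF \<theta>', of n]])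
      (auto simp: indicator_def intro!: borel_measurable_times measurable_If)
  have "expectation (\<lambda>\<omega>. likelihood_ratio \<theta>' n \<omega> * indicator {\<omega>. r < cmod (\<theta>hat n \<omega> - \<theta>')} \<omega>)
      \<le> real (card N) * exp (- T\<^sup>2 / 4 + 7 * T ^ 3) ^ n" if n: "3 \<le> n" for n
  proof -
    have "expectation (\<lambda>\<omega>. likelihood_ratio \<theta>' n \<omega> * indicator {\<omega>. r < cmod (\<theta>hat n \<omega> - \<theta>')} \<omega>)
        \<le> expectation (\<lambda>\<omega>. \<Sum>e\<in>N. ?bad n e \<omega>)"
    proof (rule integral_mono_AE)
      show "AE \<omega> in M. likelihood_ratio \<theta>' n \<omega> * indicator {\<omega>. r < cmod (\<theta>hat n \<omega> - \<theta>')} \<omega>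
          \<le> (\<Sum>e\<in>N. ?bad n e \<omega>)"
        using mle[OF n]
      proof eventually_elim
        case (elim \<omega>)
        have nonneg: "0 \<le> ?bad n e \<omega>" for e
          using likelihood_ratio_pos[OF \<theta>', of n \<omega>] by (simp add: indicator_def)
        show ?case
        proof (cases "\<exists>e\<in>N. (\<Sum>j<n. f e (X j \<omega>)) \<le> 0")
          case True
          then obtain e where e: "e \<in> N" "(\<Sum>j<n. f e (X j \<omega>)) \<le> 0"
            by blast
          then have "likelihood_ratio \<theta>' n \<omega> \<le> (\<Sum>e\<in>N. ?bad n e \<omega>)"
            using member_le_sum[of e N "\<lambda>e. ?bad n e \<omega>"] N(1) nonneg by simp
          then show ?thesis
            using sum_nonneg[of N "\<lambda>e. ?bad n e \<omega>"] nonneg by (simp add: indicator_def)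
        next
          case False
          \<comment> \<open>Positive scores on the net supply a maximizer, so the conditional
            assumption applies to the estimator.\<close>
          then have "(\<exists>\<alpha>. is_cauchy_mle n (\<lambda>j. X j \<omega>) \<alpha>) \<and>
              (\<forall>\<alpha>. is_cauchy_mle n (\<lambda>j. X j \<omega>) \<alpha> \<longrightarrow> norm (\<alpha> - \<theta>') \<le> 2 * Im \<theta>' * t / (1 - t))"
            by (intro N(3)) (auto simp: f_def not_le)
          then have "cmod (\<theta>hat n \<omega> - \<theta>') \<le> r"
            using elim r by fastforce
          then show ?thesis
            using nonneg by (simp add: sum_nonneg)
        qed
      qed
    qed (intro int_bad Bochner_Integration.integrable_sum; measurable)+
    also have "\<dots> = (\<Sum>e\<in>N. expectation (?bad n e))"
      by (intro Bochner_Integration.integral_sum int_bad) measurable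
    also have "\<dots> \<le> real (card N) * exp (- T\<^sup>2 / 4 + 7 * T ^ 3) ^ n"
      using bad by (intro sum_bounded_above) auto
    finally show ?thesis .
  qed
  then show ?thesis
    by blast
qed

lemma mle_deviation_upper:
  assumes "0 < t" "t < 1" "T = 2 * t / (1 + t\<^sup>2)" "T \<le> 1/2" "2 * Im \<theta> * t / (1 - t) \<le> \<epsilon>"
  shows "\<exists>K>0. \<forall>n\<ge>3. prob {\<omega> \<in> space M. cmod (\<theta>hat n \<omega> - \<theta>) > \<epsilon>} \<le> K * exp (- T\<^sup>2 / 4 + 7 * T ^ 3) ^ n"
proof -
  obtain K where K: "\<And>n. 3 \<le> n \<Longrightarrow> expectation (\<lambda>\<omega>. likelihood_ratio \<theta> n \<omega> *
      indicator {\<omega>. \<epsilon> < cmod (\<theta>hat n \<omega> - \<theta>)} \<omega>) \<le> K * exp (- T\<^sup>2 / 4 + 7 * T ^ 3) ^ n"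
    using likelihood_ratio_mle_deviation_le[OF upper assms] by blast
  \<comment> \<open>The constant is enlarged to be positive because its logarithm is taken
    later.\<close>
  have "prob {\<omega> \<in> space M. cmod (\<theta>hat n \<omega> - \<theta>) > \<epsilon>} \<le> max K 1 * exp (- T\<^sup>2 / 4 + 7 * T ^ 3) ^ n"
    if "3 \<le> n" for n
  proof -
    have "prob {\<omega> \<in> space M. cmod (\<theta>hat n \<omega> - \<theta>) > \<epsilon>} =
        expectation (indicator {\<omega> \<in> space M. \<epsilon> < cmod (\<theta>hat n \<omega> - \<theta>)})"
      by simp
    also have "\<dots> = expectation (\<lambda>\<omega>. likelihood_ratio \<theta> n \<omega> * indicator {\<omega>. \<epsilon> < cmod (\<theta>hat n \<omega> - \<theta>)} \<omega>)"
      by (intro Bochner_Integration.integral_cong) (auto simp: likelihood_ratio_self indicator_def)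
    also have "\<dots> \<le> K * exp (- T\<^sup>2 / 4 + 7 * T ^ 3) ^ n"
      using that by (rule K)
    also have "\<dots> \<le> max K 1 * exp (- T\<^sup>2 / 4 + 7 * T ^ 3) ^ n"
      by (intro mult_right_mono) auto
    finally show ?thesis .
  qed
  then show ?thesis
    by (intro exI[of _ "max K 1"]) auto
qed

text \<open>The ratio has total mass 1. Asymptotically negligible mass lies where the estimator is
  far from \<open>\<theta>'\<close> or where the log ratio reaches \<open>n * c\<close>; elsewhere
  the estimator deviates from \<open>\<theta>\<close> by more than \<open>\<epsilon>\<close> and the
  ratio is at most \<open>exp c ^ n\<close>. Hence at least half of the mass is bounded by
  \<open>exp c ^ n\<close> times the deviation probability.\<close>

lemma mle_deviation_lower:
  assumes \<theta>': "\<theta>' \<in> upper_half_plane" and \<epsilon>: "\<epsilon> < cmod (\<theta>' - \<theta>)" and c: "cauchy_KL \<theta>' \<theta> < c"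
  shows "eventually (\<lambda>n. exp (- c) ^ n / 2 \<le> prob {\<omega> \<in> space M. cmod (\<theta>hat n \<omega> - \<theta>) > \<epsilon>}) sequentially"
proof -
  \<comment> \<open>Half of the surplus distance: an estimator within \<open>r\<close> of
    \<open>\<theta>'\<close> is still more than \<open>\<epsilon>\<close> away from
    \<open>\<theta>\<close>.\<close>
  define r where "r = (cmod (\<theta>' - \<theta>) - \<epsilon>) / 2"
  \<comment> \<open>The cap 1/60 gives \<open>T \<le> 1/30\<close>, below the threshold 1/28 at
    which the exponent stops being negative; the other term keeps the localization radius within
    \<open>r\<close>.\<close>
  define t where "t = min (1/60) (r / (4 * Im \<theta>'))"
  define T where "T = 2 * t / (1 + t\<^sup>2)"
  define q where "q = exp (- T\<^sup>2 / 4 + 7 * T ^ 3)"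
  define g where "g x = ln (cauchy_density \<theta>' x / cauchy_density \<theta> x)" for x
  have p: "0 < Im \<theta>'" "0 < r"
    using \<theta>' \<epsilon> by (auto simp: upper_half_plane_def r_def)
  have t: "0 < t" "t \<le> 1/60" "t * (4 * Im \<theta>') \<le> r"
    using p by (auto simp: t_def min_def field_simps)
  have "T \<le> 2 * t / 1"
    unfolding T_def using t by (intro divide_left_mono) (auto simp: add_pos_nonneg)
  moreover have "0 < T"
    using t by (simp add: T_def add_pos_nonneg)
  ultimately have T: "0 < T" "T \<le> 1/30"
    using t by linarith+
  have "T\<^sup>2 * (7 * T) < T\<^sup>2 * (1/4)"
    using T by (intro mult_strict_left_mono) auto
  then have q: "0 < q" "q < 1"
    by (auto simp: q_def power2_eq_square power3_eq_cube)
  have "2 * Im \<theta>' * t / (1 - t) \<le> 2 * Im \<theta>' * t / (1/2)"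
    using t p by (intro divide_left_mono) auto
  also have "\<dots> \<le> r"
    using t by (simp add: mult_ac)
  finally have r: "2 * Im \<theta>' * t / (1 - t) \<le> r" .
  have "t < 1" "T \<le> 1/2"
    using t T by auto
  then obtain K where K: "\<And>n. 3 \<le> n \<Longrightarrow> expectation (\<lambda>\<omega>. likelihood_ratio \<theta>' n \<omega> *
      indicator {\<omega>. r < cmod (\<theta>hat n \<omega> - \<theta>')} \<omega>) \<le> K * q ^ n"
    using likelihood_ratio_mle_deviation_le[OF \<theta>' t(1) _ T_def _ r] unfolding q_def by blast
  have g_meas [measurable]: "g \<in> borel_measurable borel"
    unfolding g_def by measurable
  obtain B where B: "\<And>x. \<bar>g x\<bar> \<le> B"
    unfolding g_def using cauchy_density_ratio_bounds[OF upper \<theta>'] by metis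
  have B': "\<bar>c - g x\<bar> \<le> \<bar>c\<bar> + B" for x
    using B[of x] by linarith
  have "integrable lborel (\<lambda>x. cauchy_density \<theta>' x * g x)"
    using integrable_cauchy_density_scaleR[OF \<theta>' g_meas, of B] B by simp
  \<comment> \<open>The mean of \<open>c - g\<close> under \<open>\<theta>'\<close> is positive, so
    the mass of the event that its sum is nonpositive decays geometrically.\<close>
  then have "(\<integral>x. cauchy_density \<theta>' x * (c - g x) \<partial>lborel) = c - cauchy_KL \<theta>' \<theta>"
    using cauchy_density_integral[OF \<theta>'] by (simp add: right_diff_distrib cauchy_KL_def g_def)
  then obtain l where l: "0 < l" "(\<integral>x. cauchy_density \<theta>' x * exp (- l * (c - g x)) \<partial>lborel) < 1"
    using cauchy_exp_moment_less_1[OF \<theta>', of "\<lambda>x. c - g x" "\<bar>c\<bar> + B"] B' c by auto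
  define s where "s = (\<integral>x. cauchy_density \<theta>' x * exp (- l * (c - g x)) \<partial>lborel)"
  have s: "0 \<le> s" "s < 1"
    using l cauchy_density_pos[OF \<theta>'] unfolding s_def
    by (auto intro!: integral_nonneg_AE AE_I2 mult_nonneg_nonneg intro: less_imp_le)
  have S: "expectation (\<lambda>\<omega>. likelihood_ratio \<theta>' n \<omega> * indicator {\<omega>. (\<Sum>j<n. c - g (X j \<omega>)) \<le> 0} \<omega>) \<le> s ^ n" for n
    unfolding s_def using l B'
    by (intro likelihood_ratio_chernoff[OF \<theta>', of "\<lambda>x. c - g x" "\<bar>c\<bar> + B"]) auto
  have "(\<lambda>n. K * q ^ n + s ^ n) \<longlonglongrightarrow> K * 0 + 0"
    using q s by (intro tendsto_intros LIMSEQ_power_zero) auto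
  then have "eventually (\<lambda>n. K * q ^ n + s ^ n < 1/2) sequentially"
    by (rule order_tendstoD) simp
  then show ?thesis
    using eventually_ge_at_top[of 3]
  proof eventually_elim
    case (elim n)
    let ?D = "{\<omega> \<in> space M. cmod (\<theta>hat n \<omega> - \<theta>) > \<epsilon>}"
    let ?U = "\<lambda>\<omega>. likelihood_ratio \<theta>' n \<omega> * indicator {\<omega>. r < cmod (\<theta>hat n \<omega> - \<theta>')} \<omega>"
    let ?V = "\<lambda>\<omega>. likelihood_ratio \<theta>' n \<omega> * indicator {\<omega>. (\<Sum>j<n. c - g (X j \<omega>)) \<le> 0} \<omega>"
    have int: "integrable M ?U" "integrable M ?V"
      using likelihood_ratio_pos[OF \<theta>', of n]
      by (intro Bochner_Integration.integrable_bound[OF likelihood_ratio_expectation(1)[OF \<theta>', of n]];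
          force simp: indicator_def intro!: borel_measurable_times measurable_If)+
    have int_D: "integrable M (\<lambda>\<omega>. exp c ^ n * indicator ?D \<omega>)"
      by (intro integrable_mult_right integrable_real_indicator) (auto simp: emeasure_eq_measure)
    have "1 = expectation (likelihood_ratio \<theta>' n)"
      using likelihood_ratio_expectation[OF \<theta>'] by simp
    also have "\<dots> \<le> expectation (\<lambda>\<omega>. exp c ^ n * indicator ?D \<omega> + (?U \<omega> + ?V \<omega>))"
    proof (rule integral_mono)
      show "integrable M (\<lambda>\<omega>. exp c ^ n * indicator ?D \<omega> + (?U \<omega> + ?V \<omega>))"
        by (intro Bochner_Integration.integrable_add int int_D)
      fix \<omega> assume \<omega>: "\<omega> \<in> space M"
      have R: "0 < likelihood_ratio \<theta>' n \<omega>"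
        by (rule likelihood_ratio_pos[OF \<theta>'])
      show "likelihood_ratio \<theta>' n \<omega> \<le> exp c ^ n * indicator ?D \<omega> + (?U \<omega> + ?V \<omega>)"
      proof (cases "r < cmod (\<theta>hat n \<omega> - \<theta>') \<or> (\<Sum>j<n. c - g (X j \<omega>)) \<le> 0")
        case True
        then show ?thesis
          using R by (auto simp: indicator_def)
      next
        case False
        have "cmod (\<theta>' - \<theta>) \<le> cmod (\<theta>hat n \<omega> - \<theta>') + cmod (\<theta>hat n \<omega> - \<theta>)"
          using norm_triangle_ineq4[of "\<theta>hat n \<omega> - \<theta>" "\<theta>hat n \<omega> - \<theta>'"] by simp
        then have "\<omega> \<in> ?D"
          using False \<omega> p(2) by (auto simp: r_def)
        have "likelihood_ratio \<theta>' n \<omega> = exp (\<Sum>j<n. g (X j \<omega>))"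
          using upper \<theta>' by (simp add: likelihood_ratio_def g_def exp_sum cauchy_density_pos)
        also have "\<dots> \<le> exp (real n * c)"
          using False by (simp add: sum_subtractf)
        also have "\<dots> = exp c ^ n"
          by (simp add: exp_of_nat_mult)
        finally show ?thesis
          using \<open>\<omega> \<in> ?D\<close> R by (simp add: indicator_def)
      qed
    qed (rule likelihood_ratio_expectation(1)[OF \<theta>'])
    also have "\<dots> = exp c ^ n * prob ?D + (expectation ?U + expectation ?V)"
      using int int_D by (subst Bochner_Integration.integral_add) auto
    also have "\<dots> \<le> exp c ^ n * prob ?D + 1/2"
      using K[OF elim(2)] S[of n] elim(1) by simp
    finally have "1/2 \<le> exp c ^ n * prob ?D"
      by simp
    then have "exp (- c) ^ n * (1/2) \<le> exp (- c) ^ n * (exp c ^ n * prob ?D)"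
      by (intro mult_left_mono) auto
    also have "\<dots> = prob ?D"
      by (simp add: mult.assoc[symmetric] power_mult_distrib[symmetric] exp_minus)
    finally show ?case
      by simp
  qed
qed

end

section \<open>Logarithmic rates and the double limit\<close>

context cauchy_mle
begin

text \<open>Every \<open>c\<close> above the infimum exceeds the divergence of some admissible
  \<open>\<theta>'\<close>; the factor 1/2 disappears after division by \<open>n\<close>, and
  \<open>c\<close> then tends to the infimum. Positivity of the probabilities is recorded because
  the upper bound needs monotonicity of \<open>ln\<close>.\<close>

lemma mle_rate_ge:
  assumes \<epsilon>: "0 < \<epsilon>"
  shows "eventually (\<lambda>n. 0 < prob {\<omega> \<in> space M. cmod (\<theta>hat n \<omega> - \<theta>) > \<epsilon>}) sequentially"
    and "-1 \<le> limsup (\<lambda>n. ereal (ln (prob {\<omega> \<in> space M. cmod (\<theta>hat n \<omega> - \<theta>) > \<epsilon>})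
                    / (real n * cauchy_b \<epsilon> \<theta>)))"
proof -
  let ?P = "\<lambda>n. prob {\<omega> \<in> space M. cmod (\<theta>hat n \<omega> - \<theta>) > \<epsilon>}"
  define b where "b = cauchy_b \<epsilon> \<theta>"
  have b: "0 < b"
    unfolding b_def using cauchy_b_bounds(1)[OF upper \<epsilon>] .
  have ev: "eventually (\<lambda>n. exp (- c) ^ n / 2 \<le> ?P n) sequentially" if "b < c" for c
    using cauchy_b_bounds(3)[OF upper \<epsilon> that[unfolded b_def]] mle_deviation_lower[of _ \<epsilon> c] by blast
  show "eventually (\<lambda>n. 0 < ?P n) sequentially"
    by (rule eventually_mono[OF ev[of "b + 1"]]) (simp, rule less_le_trans[rotated], assumption, simp)
  have "- 1 \<le> limsup (\<lambda>n. ereal (ln (?P n) / (real n * b))) + ereal d" if d: "0 < d" for d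
  proof -
    define c where "c = b * (1 + d)"
    have c: "b < c"
      unfolding c_def using b d by simp
    have "(\<lambda>n. - c / b - ln 2 / b * inverse (real n)) \<longlonglongrightarrow> - c / b - ln 2 / b * 0"
      using b by (intro tendsto_intros LIMSEQ_inverse_real_of_nat lim_inverse_n) auto
    then have "limsup (\<lambda>n. ereal (- c / b - ln 2 / b * inverse (real n))) = ereal (- c / b)"
      by (intro lim_imp_Limsup) auto
    moreover have "limsup (\<lambda>n. ereal (- c / b - ln 2 / b * inverse (real n)))
        \<le> limsup (\<lambda>n. ereal (ln (?P n) / (real n * b)))"
    proof (rule Limsup_mono)
      show "eventually (\<lambda>n. ereal (- c / b - ln 2 / b * inverse (real n))
          \<le> ereal (ln (?P n) / (real n * b))) sequentially"
        using ev[OF c] eventually_gt_at_top[of 0]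
      proof eventually_elim
        case (elim n)
        have "ln (exp (- c) ^ n / 2) \<le> ln (?P n)"
          using elim(1) by (intro ln_mono) auto
        then have "- real n * c - ln 2 \<le> ln (?P n)"
          by (simp add: ln_div ln_realpow)
        then have "(- real n * c - ln 2) / (real n * b) \<le> ln (?P n) / (real n * b)"
          using b by (intro divide_right_mono) auto
        moreover have "(- real n * c - ln 2) / (real n * b) = - c / b - ln 2 / b * inverse (real n)"
          using b elim(2) by (simp add: field_simps)
        ultimately show ?case
          by simp
      qed
    qed
    moreover have "- c / b = - 1 - d"
      using b by (simp add: c_def field_simps)
    ultimately have "ereal (- 1 - d) \<le> limsup (\<lambda>n. ereal (ln (?P n) / (real n * b)))"
      by simp
    then have "ereal (- 1 - d) + ereal d \<le> limsup (\<lambda>n. ereal (ln (?P n) / (real n * b))) + ereal d"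
      by (rule add_right_mono)
    then show ?thesis
      by (simp add: one_ereal_def)
  qed
  then show "- 1 \<le> limsup (\<lambda>n. ereal (ln (?P n) / (real n * cauchy_b \<epsilon> \<theta>)))"
    unfolding b_def[symmetric] by (rule ereal_le_epsilon2) blast
qed

text \<open>This \<open>t\<close> solves \<open>2 * Im \<theta> * t / (1 - t) = \<epsilon>\<close>,
  the largest radius the localization permits. The condition \<open>T \<le> 1/28\<close> makes the
  exponent nonpositive.\<close>

lemma mle_rate_le:
  assumes \<epsilon>: "0 < \<epsilon>" and t: "t = \<epsilon> / (2 * Im \<theta> + \<epsilon>)" and T: "T = 2 * t / (1 + t\<^sup>2)" "T \<le> 1/28"
  shows "limsup (\<lambda>n. ereal (ln (prob {\<omega> \<in> space M. cmod (\<theta>hat n \<omega> - \<theta>) > \<epsilon>})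
                    / (real n * cauchy_b \<epsilon> \<theta>))) \<le> ereal ((- T\<^sup>2 / 4 + 7 * T ^ 3) * (4 * (Im \<theta>)\<^sup>2 / \<epsilon>\<^sup>2))"
proof -
  let ?P = "\<lambda>n. prob {\<omega> \<in> space M. cmod (\<theta>hat n \<omega> - \<theta>) > \<epsilon>}"
  define b where "b = cauchy_b \<epsilon> \<theta>"
  define a where "a = - T\<^sup>2 / 4 + 7 * T ^ 3"
  have b: "0 < b" "b \<le> \<epsilon>\<^sup>2 / (4 * (Im \<theta>)\<^sup>2)"
    unfolding b_def using cauchy_b_bounds[OF upper \<epsilon>] by auto
  have p: "0 < Im \<theta>"
    using upper by (simp add: upper_half_plane_def)
  have t': "0 < t" "t < 1" "2 * Im \<theta> * t / (1 - t) \<le> \<epsilon>"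
  proof -
    show "0 < t" "t < 1"
      using p \<epsilon> by (auto simp: t)
    have "1 - t = 2 * Im \<theta> / (2 * Im \<theta> + \<epsilon>)"
      using p \<epsilon> by (simp add: t field_simps)
    then show "2 * Im \<theta> * t / (1 - t) \<le> \<epsilon>"
      using p \<epsilon> by (simp add: t)
  qed
  have T0: "0 < T"
    unfolding T(1) using t' by (simp add: add_pos_nonneg)
  have "T\<^sup>2 * (7 * T) \<le> T\<^sup>2 * (1/4)"
    using T(2) by (intro mult_left_mono) auto
  then have a: "a \<le> 0"
    by (simp add: a_def power2_eq_square power3_eq_cube)
  obtain K where K: "0 < K" "\<And>n. 3 \<le> n \<Longrightarrow> ?P n \<le> K * exp a ^ n"
    using mle_deviation_upper[OF t'(1,2) T(1) _ t'(3)] T(2) unfolding a_def by auto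
  have "limsup (\<lambda>n. ereal (ln (?P n) / (real n * b))) \<le> limsup (\<lambda>n. ereal (ln K / b * inverse (real n) + a / b))"
  proof (rule Limsup_mono)
    show "eventually (\<lambda>n. ereal (ln (?P n) / (real n * b)) \<le> ereal (ln K / b * inverse (real n) + a / b)) sequentially"
      using mle_rate_ge(1)[OF \<epsilon>] eventually_ge_at_top[of 3]
    proof eventually_elim
      case (elim n)
      have "ln (?P n) \<le> ln (K * exp a ^ n)"
        using elim K by (intro ln_mono) auto
      also have "\<dots> = ln K + real n * a"
        using K by (simp add: ln_mult ln_realpow)
      finally have "ln (?P n) / (real n * b) \<le> (ln K + real n * a) / (real n * b)"
        using b by (intro divide_right_mono) auto
      also have "\<dots> = ln K / b * inverse (real n) + a / b"
        using b elim(2) by (simp add: field_simps)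
      finally show ?case
        by simp
    qed
  qed
  also have "(\<lambda>n. ln K / b * inverse (real n) + a / b) \<longlonglongrightarrow> ln K / b * 0 + a / b"
    using b by (intro tendsto_intros lim_inverse_n) auto
  then have "limsup (\<lambda>n. ereal (ln K / b * inverse (real n) + a / b)) = ereal (a / b)"
    by (intro lim_imp_Limsup) auto
  \<comment> \<open>As \<open>a\<close> is nonpositive, enlarging the denominator increases the
    quotient; hence an upper bound on \<open>cauchy_b\<close> is what is needed.\<close>
  also have "a / b \<le> a / (\<epsilon>\<^sup>2 / (4 * (Im \<theta>)\<^sup>2))"
    using a b p \<epsilon> by (intro divide_left_mono_neg) auto
  finally show ?thesis
    by (simp add: a_def b_def)
qed

text \<open>The lower bound holds for each fixed \<open>\<epsilon>\<close>; only the upper bound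
  needs small \<open>\<epsilon>\<close>.\<close>

theorem mle_bahadur_efficient:
  "Limsup (at_right 0) (\<lambda>\<epsilon>. limsup (\<lambda>n.
     ereal (ln (prob {\<omega> \<in> space M. cmod (\<theta>hat n \<omega> - \<theta>) > \<epsilon>}) / (real n * cauchy_b \<epsilon> \<theta>)))) = -1"
proof (rule antisym)
  define \<sigma> where "\<sigma> = Im \<theta>"
  have \<sigma>: "0 < \<sigma>"
    using upper by (simp add: \<sigma>_def upper_half_plane_def)
  define t where "t \<epsilon> = \<epsilon> / (2 * \<sigma> + \<epsilon>)" for \<epsilon>
  define T where "T \<epsilon> = 2 * t \<epsilon> / (1 + (t \<epsilon>)\<^sup>2)" for \<epsilon>
  let ?h = "\<lambda>\<epsilon>. (- (T \<epsilon>)\<^sup>2 / 4 + 7 * T \<epsilon> ^ 3) * (4 * \<sigma>\<^sup>2 / \<epsilon>\<^sup>2)"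
  have "(T \<longlongrightarrow> 0) (at_right 0)"
    unfolding T_def t_def using \<sigma> by real_asymp
  then have "eventually (\<lambda>\<epsilon>. T \<epsilon> < 1/28) (at_right 0)"
    by (rule order_tendstoD) simp
  then have "eventually (\<lambda>\<epsilon>. limsup (\<lambda>n. ereal (ln (prob {\<omega> \<in> space M. cmod (\<theta>hat n \<omega> - \<theta>) > \<epsilon>})
      / (real n * cauchy_b \<epsilon> \<theta>))) \<le> ereal (?h \<epsilon>)) (at_right 0)"
    using eventually_at_right_less[of 0]
    by eventually_elim (use mle_rate_le T_def t_def in \<open>simp add: \<sigma>_def\<close>)
  then have "Limsup (at_right 0) (\<lambda>\<epsilon>. limsup (\<lambda>n.
     ereal (ln (prob {\<omega> \<in> space M. cmod (\<theta>hat n \<omega> - \<theta>) > \<epsilon>}) / (real n * cauchy_b \<epsilon> \<theta>))))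
    \<le> Limsup (at_right 0) (\<lambda>\<epsilon>. ereal (?h \<epsilon>))"
    by (rule Limsup_mono)
  \<comment> \<open>\<open>T \<epsilon>\<close> is asymptotic to
    \<open>\<epsilon> / \<sigma>\<close>: the quadratic part tends to -1 and the cubic part, of
    order \<open>\<epsilon>\<close> after normalization, vanishes.\<close>
  also have "(?h \<longlongrightarrow> -1) (at_right 0)"
    unfolding T_def t_def using \<sigma> by (real_asymp, simp add: field_simps)
  then have "Limsup (at_right 0) (\<lambda>\<epsilon>. ereal (?h \<epsilon>)) = ereal (-1)"
    by (intro lim_imp_Limsup) auto
  finally show "Limsup (at_right 0) (\<lambda>\<epsilon>. limsup (\<lambda>n.
     ereal (ln (prob {\<omega> \<in> space M. cmod (\<theta>hat n \<omega> - \<theta>) > \<epsilon>}) / (real n * cauchy_b \<epsilon> \<theta>)))) \<le> -1"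
    by (simp add: one_ereal_def)
  have "eventually (\<lambda>\<epsilon>::real. 0 < \<epsilon>) (at_right 0)"
    by (rule eventually_at_right_less)
  then show "-1 \<le> Limsup (at_right 0) (\<lambda>\<epsilon>. limsup (\<lambda>n.
     ereal (ln (prob {\<omega> \<in> space M. cmod (\<theta>hat n \<omega> - \<theta>) > \<epsilon>}) / (real n * cauchy_b \<epsilon> \<theta>))))"
    by (intro le_Limsup) (auto elim!: eventually_mono intro: mle_rate_ge)
qed

end

theorem theorem3p2:
  fixes M :: "'a measure"
    and X :: "nat \<Rightarrow> 'a \<Rightarrow> real"
    and \<mu> \<sigma> :: real
    and \<theta> :: complex
    and \<theta>hat :: "nat \<Rightarrow> 'a \<Rightarrow> complex"
  assumes "prob_space M"
    and "\<sigma> > 0"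
    and "\<theta> = Complex \<mu> \<sigma>"
    and "prob_space.indep_vars M (\<lambda>_. borel) X UNIV"
    and "\<And>j. distributed M lborel (X j) (\<lambda>x. ennreal (cauchy_density \<theta> x))"
    and "\<And>n. \<theta>hat n \<in> borel_measurable M"
    and "\<And>n. n \<ge> 3 \<Longrightarrow> AE \<omega> in M. (\<exists>\<alpha>. is_cauchy_mle n (\<lambda>j. X j \<omega>) \<alpha>) \<longrightarrow>
                 is_cauchy_mle n (\<lambda>j. X j \<omega>) (\<theta>hat n \<omega>)"
  shows "Limsup (at_right 0) (\<lambda>\<epsilon>. limsup (\<lambda>n.
           ereal (ln (measure M {\<omega> \<in> space M. cmod (\<theta>hat n \<omega> - \<theta>) > \<epsilon>})
                    / (real n * cauchy_b \<epsilon> \<theta>)))) = -1"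
proof -
  interpret prob_space M
    by (rule assms(1))
  interpret cauchy_mle M X \<theta> \<theta>hat
    by unfold_locales (use assms in \<open>auto simp: upper_half_plane_def\<close>)
  show ?thesis
    by (rule mle_bahadur_efficient)
qed

end
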